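(* Let $\|\cdot\|$ be an admissible norm on $\mathbb{R}^3$ and let $f:M\to(\mathbb{R}^3,\|\cdot\|)$ be a compact, connected immersed surface. If the Minkowski Gaussian curvature of $M$ is positive, then the Birkhoff-Gauss map $\eta:M\to\partial B$ is a diffeomorphism.
   Context: A norm $\|\cdot\|$ on $\mathbb{R}^3$ is admissible if its unit sphere $\partial B=\{x\in\mathbb{R}^3:\|x\|=1\}$ is a smooth surface of strictly positive Gaussian curvature in the usual Euclidean geometry of $\mathbb{R}^3$. A non-zero vector $v$ is Birkhoff orthogonal to a plane $P$ (through the origin), written $v\dashv_B P$, if $\|v+tw\|\ge\|v\|$ for all $t\in\mathbb{R}$, $w\in P$. Surfaces are smooth (without boundary) and orientable, immersions are smooth, and $T_pM$ is regarded as a plane in $\mathbb{R}^3$. The Birkhoff-Gauss map $\eta:M\to\partial B$ is a globally defined smooth map with $\eta(p)\dashv_B T_pM$ for all $p$ (one of the two choices is fixed). Since $T_{\eta(p)}\partial B$ is parallel to $T_pM$, $d\eta_p$ is an endomorphism of $T_pM$; the Minkowski Gaussian curvature is $K(p)=\det(d\eta_p)$. *)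

theory Defs
  imports "HOL-Analysis.Analysis"
begin

section \<open>Smooth maps between normed spaces\<close>

text \<open>Both notions are meant for open \<open>S\<close>: iterated directional derivatives of every order exist
  and are continuous.\<close>

fun higher_differentiable_on ::
    "'a::real_normed_vector set \<Rightarrow> ('a \<Rightarrow> 'b::real_normed_vector) \<Rightarrow> nat \<Rightarrow> bool" where
  "higher_differentiable_on S f 0 \<longleftrightarrow> continuous_on S f"
| "higher_differentiable_on S f (Suc k) \<longleftrightarrow>
     (\<forall>x\<in>S. f differentiable (at x)) \<and>
     (\<forall>v. higher_differentiable_on S (\<lambda>x. frechet_derivative f (at x) v) k)"

definition smooth_on :: "'a::real_normed_vector set \<Rightarrow> ('a \<Rightarrow> 'b::real_normed_vector) \<Rightarrow> bool" where
  "smooth_on S f \<longleftrightarrow> (\<forall>k. higher_differentiable_on S f k)"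

section \<open>Smooth surfaces\<close>

text \<open>A chart is a pair \<open>(U, \<phi>)\<close>; only the values of \<open>\<phi>\<close> on \<open>U\<close> matter, and its inverse
  \<open>\<phi> ` U \<rightarrow> U\<close> is \<open>inv_into U \<phi>\<close>. A surface is a subset \<open>M\<close> (with the subspace topology) of a
  Hausdorff second countable space, together with a smooth atlas, which need not be maximal.\<close>

type_synonym 'm chart = "'m set \<times> ('m \<Rightarrow> real^2)"

definition is_chart :: "'m::topological_space set \<Rightarrow> 'm chart \<Rightarrow> bool" where
  "is_chart M = (\<lambda>(U, \<phi>). openin (top_of_set M) U \<and> open (\<phi> ` U) \<and>
     homeomorphism U (\<phi> ` U) \<phi> (inv_into U \<phi>))"

definition smooth_atlas :: "'m::topological_space set \<Rightarrow> 'm chart set \<Rightarrow> bool" where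
  "smooth_atlas M A \<longleftrightarrow> (\<forall>c\<in>A. is_chart M c) \<and> (\<Union>(U, \<phi>)\<in>A. U) = M \<and>
     (\<forall>(U, \<phi>)\<in>A. \<forall>(V, \<psi>)\<in>A. smooth_on (\<phi> ` (U \<inter> V)) (\<psi> \<circ> inv_into U \<phi>))"

definition orientable_surface :: "'m::topological_space set \<Rightarrow> 'm chart set \<Rightarrow> bool" where
  "orientable_surface M A \<longleftrightarrow> (\<exists>B. smooth_atlas M B \<and> smooth_atlas M (A \<union> B) \<and>
     (\<forall>(U, \<phi>)\<in>B. \<forall>(V, \<psi>)\<in>B. \<forall>x\<in>\<phi> ` (U \<inter> V).
        det (matrix (frechet_derivative (\<psi> \<circ> inv_into U \<phi>) (at x))) > 0))"

text \<open>Smoothness of a vector-valued function on an open subset \<open>W\<close> of a surface with atlas \<open>A\<close>.\<close>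

definition smooth_fun :: "'m chart set \<Rightarrow> 'm set \<Rightarrow> ('m \<Rightarrow> 'b::real_normed_vector) \<Rightarrow> bool" where
  "smooth_fun A W g \<longleftrightarrow> (\<forall>(U, \<phi>)\<in>A. smooth_on (\<phi> ` (U \<inter> W)) (g \<circ> inv_into U \<phi>))"

definition smooth_surface_map ::
    "'m::topological_space set \<Rightarrow> 'm chart set \<Rightarrow> 'n::topological_space set \<Rightarrow> 'n chart set \<Rightarrow>
     ('m \<Rightarrow> 'n) \<Rightarrow> bool" where
  "smooth_surface_map M A M' A' g \<longleftrightarrow> g ` M \<subseteq> M' \<and> continuous_on M g \<and>
     (\<forall>(U, \<phi>)\<in>A. \<forall>(V, \<psi>)\<in>A'. smooth_on (\<phi> ` (U \<inter> g -` V)) (\<psi> \<circ> g \<circ> inv_into U \<phi>))"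

definition surface_diffeomorphism ::
    "'m::topological_space set \<Rightarrow> 'm chart set \<Rightarrow> 'n::topological_space set \<Rightarrow> 'n chart set \<Rightarrow>
     ('m \<Rightarrow> 'n) \<Rightarrow> bool" where
  "surface_diffeomorphism M A M' A' g \<longleftrightarrow> bij_betw g M M' \<and>
     smooth_surface_map M A M' A' g \<and> smooth_surface_map M' A' M A (inv_into M g)"

section \<open>Immersions into space and their tangent planes\<close>

definition immersed_surface :: "'m::topological_space set \<Rightarrow> 'm chart set \<Rightarrow> ('m \<Rightarrow> real^3) \<Rightarrow> bool"
  where
  "immersed_surface M A f \<longleftrightarrow> smooth_atlas M A \<and> smooth_fun A M f \<and>
     (\<forall>(U, \<phi>)\<in>A. \<forall>x\<in>\<phi> ` U. inj (frechet_derivative (f \<circ> inv_into U \<phi>) (at x)))"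

text \<open>The tangent plane at \<open>p\<close>, as the linear subspace \<open>df\<^sub>p(T\<^sub>pM)\<close> of space. All charts around
  \<open>p\<close> contribute the same plane to the union.\<close>

definition tangent_plane :: "'m chart set \<Rightarrow> ('m \<Rightarrow> real^3) \<Rightarrow> 'm \<Rightarrow> (real^3) set" where
  "tangent_plane A f p =
     (\<Union>(U, \<phi>)\<in>{c\<in>A. p \<in> fst c}. range (frechet_derivative (f \<circ> inv_into U \<phi>) (at (\<phi> p))))"

text \<open>The differential at \<open>p\<close> of a map \<open>g\<close> from the surface to space, as a map on the tangent
  plane \<open>df\<^sub>p(T\<^sub>pM)\<close>, that is, \<open>dg\<^sub>p \<circ> (df\<^sub>p)\<^sup>-\<^sup>1\<close>. Its values off the tangent plane are
  irrelevant.\<close>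

definition tangent_differential ::
    "'m chart set \<Rightarrow> ('m \<Rightarrow> real^3) \<Rightarrow> ('m \<Rightarrow> real^3) \<Rightarrow> 'm \<Rightarrow> real^3 \<Rightarrow> real^3" where
  "tangent_differential A f g p w =
     (THE u. \<exists>(U, \<phi>)\<in>A. p \<in> U \<and>
        (\<exists>v. w = frechet_derivative (f \<circ> inv_into U \<phi>) (at (\<phi> p)) v \<and>
             u = frechet_derivative (g \<circ> inv_into U \<phi>) (at (\<phi> p)) v))"

text \<open>The determinant of a linear endomorphism \<open>L\<close> of a plane \<open>P\<close>: that of its matrix with respect
  to an arbitrary basis \<open>b\<close> of \<open>P\<close>.\<close>

definition plane_det :: "(real^3) set \<Rightarrow> (real^3 \<Rightarrow> real^3) \<Rightarrow> real" where
  "plane_det P L =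
     (THE d. \<exists>(b :: 2 \<Rightarrow> real^3) (a :: real^2^2).
        inj b \<and> independent (range b) \<and> span (range b) = P \<and>
        (\<forall>j. L (b j) = (\<Sum>i\<in>UNIV. a $ i $ j *\<^sub>R b i)) \<and> d = det a)"

section \<open>Embedded surfaces and their Euclidean Gaussian curvature\<close>

text \<open>The charts of a subset \<open>S\<close> of space are the inverses of its smooth regular local
  parametrizations; if they cover \<open>S\<close>, they form its standard (maximal) atlas.\<close>

definition embedded_charts :: "(real^3) set \<Rightarrow> (real^3) chart set" where
  "embedded_charts S = {(U, \<phi>). is_chart S (U, \<phi>) \<and> smooth_on (\<phi> ` U) (inv_into U \<phi>) \<and>
     (\<forall>x\<in>\<phi> ` U. inj (frechet_derivative (inv_into U \<phi>) (at x)))}"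

definition embedded_surface :: "(real^3) set \<Rightarrow> bool" where
  "embedded_surface S \<longleftrightarrow> S = (\<Union>(U, \<phi>)\<in>embedded_charts S. U)"

abbreviation embedded_tangent_plane :: "(real^3) set \<Rightarrow> real^3 \<Rightarrow> (real^3) set" where
  "embedded_tangent_plane S \<equiv> tangent_plane (embedded_charts S) (\<lambda>x. x)"

text \<open>The determinant of the differential of a smooth unit normal field defined near \<open>p\<close>; it does
  not depend on the choice between the two fields.\<close>

definition euclidean_gaussian_curvature :: "(real^3) set \<Rightarrow> real^3 \<Rightarrow> real" where
  "euclidean_gaussian_curvature S p =
     (THE k. \<exists>W \<nu>. openin (top_of_set S) W \<and> p \<in> W \<and> smooth_fun (embedded_charts S) W \<nu> \<and>
        (\<forall>q\<in>W. norm (\<nu> q) = 1 \<and> (\<forall>w\<in>embedded_tangent_plane S q. \<nu> q \<bullet> w = 0)) \<and>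
        k = plane_det (embedded_tangent_plane S p)
              (tangent_differential (embedded_charts S) (\<lambda>x. x) \<nu> p))"

section \<open>Admissible norms and the geometry of immersed surfaces\<close>

definition is_norm :: "(real^3 \<Rightarrow> real) \<Rightarrow> bool" where
  "is_norm N \<longleftrightarrow> (\<forall>x. N x \<ge> 0) \<and> (\<forall>x. N x = 0 \<longleftrightarrow> x = 0) \<and>
     (\<forall>c x. N (c *\<^sub>R x) = \<bar>c\<bar> * N x) \<and> (\<forall>x y. N (x + y) \<le> N x + N y)"

definition unit_sphere :: "(real^3 \<Rightarrow> real) \<Rightarrow> (real^3) set" where
  "unit_sphere N = {x. N x = 1}"

definition admissible_norm :: "(real^3 \<Rightarrow> real) \<Rightarrow> bool" where
  "admissible_norm N \<longleftrightarrow> is_norm N \<and> embedded_surface (unit_sphere N) \<and>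
     (\<forall>x\<in>unit_sphere N. euclidean_gaussian_curvature (unit_sphere N) x > 0)"

definition birkhoff_orthogonal :: "(real^3 \<Rightarrow> real) \<Rightarrow> real^3 \<Rightarrow> (real^3) set \<Rightarrow> bool" where
  "birkhoff_orthogonal N v P \<longleftrightarrow> v \<noteq> 0 \<and> (\<forall>t. \<forall>w\<in>P. N (v + t *\<^sub>R w) \<ge> N v)"

definition birkhoff_gauss_map ::
    "(real^3 \<Rightarrow> real) \<Rightarrow> 'm::topological_space set \<Rightarrow> 'm chart set \<Rightarrow> ('m \<Rightarrow> real^3) \<Rightarrow>
     ('m \<Rightarrow> real^3) \<Rightarrow> bool" where
  "birkhoff_gauss_map N M A f \<eta> \<longleftrightarrow>
     smooth_surface_map M A (unit_sphere N) (embedded_charts (unit_sphere N)) \<eta> \<and>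
     (\<forall>p\<in>M. birkhoff_orthogonal N (\<eta> p) (tangent_plane A f p))"

definition minkowski_gaussian_curvature ::
    "'m chart set \<Rightarrow> ('m \<Rightarrow> real^3) \<Rightarrow> ('m \<Rightarrow> real^3) \<Rightarrow> 'm \<Rightarrow> real" where
  "minkowski_gaussian_curvature A f \<eta> p =
     plane_det (tangent_plane A f p) (tangent_differential A f \<eta> p)"

end

theory Submission
  imports Defs
begin

text \<open>
  The curvature hypothesis makes \<open>\<eta>\<close> a local diffeomorphism onto the unit sphere \<open>S\<close> of the norm,
  and a local homeomorphism from a compact space to a connected, simply connected one is a
  one-sheeted covering, that is, a homeomorphism.

  For the first point, let \<open>P = T\<^sub>pM\<close>. Birkhoff orthogonality says that \<open>\<eta>(p) + P\<close> supports the
  unit ball at \<open>\<eta>(p)\<close>: the linear functional with kernel \<open>P\<close> and value \<open>1\<close> at \<open>\<eta>(p)\<close> is bounded by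
  the norm, so it attains its maximum over \<open>S\<close> at \<open>\<eta>(p)\<close>, and its derivative vanishes along every
  differentiable map into \<open>S\<close> through that point (\<open>birkhoff_orthogonal_tangent\<close>). Applied to \<open>\<eta>\<close>
  itself in a chart, this shows that \<open>d\<eta>\<^sub>p\<close> maps \<open>P\<close> to \<open>P\<close>. Hence the determinant that
  defines the Minkowski Gaussian curvature is a genuine one, and it would be \<open>0\<close> if \<open>d\<eta>\<^sub>p\<close>
  had a kernel (\<open>plane_det_eq_0\<close>). So \<open>d\<eta>\<^sub>p\<close> is injective; in charts, \<open>\<eta>\<close> is then injective near
  \<open>p\<close>, and open by invariance of domain (\<open>gauss_local_homeomorphism\<close>).

  For the second point, the surface is embedded into the product of the target space and a space
  of bounded sequences, by pairing \<open>\<eta>\<close> with finitely many bump functions. This turns an abstract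
  topological space into a subset of a normed space, and \<open>\<eta>\<close> into the projection to the first
  factor, which is a covering of \<open>S\<close>. As \<open>S\<close> is homeomorphic to a round sphere, it is simply
  connected, so the covering has a global section; the image of the section is open and closed,
  hence everything (\<open>local_homeomorphism_simply_connected_bij_betw\<close>).

  Finally, the inverse of \<open>\<eta>\<close> is continuous by compactness. In charts it inverts a smooth map with
  invertible derivative, and Cramer's rule expresses its derivative through itself and
  the partial derivatives of that map; so it gains one order of differentiability after another
  (\<open>smooth_on_right_inverse\<close>).
\<close>

section \<open>Smooth maps and their inverses\<close>

lemma frechet_derivative_cong_open:
  assumes "open S" "x \<in> S" "\<And>y. y \<in> S \<Longrightarrow> f y = g y"
  shows "frechet_derivative f (at x) = frechet_derivative g (at x)"
proof -
  have "(f has_derivative D) (at x) \<longleftrightarrow> (g has_derivative D) (at x)" for D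
    using has_derivative_transform_within_open[OF _ assms(1,2), of f D UNIV g]
      has_derivative_transform_within_open[OF _ assms(1,2), of g D UNIV f] assms(3)
    by auto
  then show ?thesis
    unfolding frechet_derivative_def by simp
qed

lemma differentiable_cong_open:
  assumes "open S" "x \<in> S" "\<And>y. y \<in> S \<Longrightarrow> f y = g y" "f differentiable (at x)"
  shows "g differentiable (at x)"
  using assms has_derivative_transform_within_open[OF _ assms(1,2), of f _ UNIV g]
  unfolding differentiable_def by blast

lemma higher_differentiable_on_cong:
  assumes "open S" "\<And>x. x \<in> S \<Longrightarrow> f x = g x" "higher_differentiable_on S f k"
  shows "higher_differentiable_on S g k"
  using assms(2,3)
proof (induction k arbitrary: f g)
  case 0
  then show ?case using continuous_on_cong[of S S f g] by simp
next
  case (Suc k)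
  have "g differentiable (at x)" if "x \<in> S" for x
    using differentiable_cong_open[OF assms(1) that Suc.prems(1)] Suc.prems(2) that by simp
  moreover have "higher_differentiable_on S (\<lambda>x. frechet_derivative g (at x) v) k" for v
  proof (rule Suc.IH)
    show "frechet_derivative f (at x) v = frechet_derivative g (at x) v" if "x \<in> S" for x
      using frechet_derivative_cong_open[OF assms(1) that Suc.prems(1)] by simp
  qed (use Suc.prems(2) in simp)
  ultimately show ?case by simp
qed

text \<open>The derivative may be given by any expression \<open>D\<close>: this avoids computing with
  \<^const>\<open>frechet_derivative\<close> in the closure properties that follow.\<close>

lemma higher_differentiable_on_SucI:
  assumes "open S" "\<And>x. x \<in> S \<Longrightarrow> (f has_derivative D x) (at x)"
    and "\<And>v. higher_differentiable_on S (\<lambda>x. D x v) k"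
  shows "higher_differentiable_on S f (Suc k)"
proof -
  have "higher_differentiable_on S (\<lambda>x. frechet_derivative f (at x) v) k" for v
  proof (rule higher_differentiable_on_cong[OF assms(1) _ assms(3)])
    show "D x v = frechet_derivative f (at x) v" if "x \<in> S" for x
      using frechet_derivative_at[OF assms(2)[OF that]] by simp
  qed
  then show ?thesis
    using assms(2) by (auto simp: differentiable_def)
qed

lemma higher_differentiable_on_SucD:
  assumes "higher_differentiable_on S f (Suc k)"
  shows "higher_differentiable_on S f k"
  using assms
proof (induction k arbitrary: f)
  case 0
  then show ?case
    by (auto intro!: continuous_at_imp_continuous_on differentiable_imp_continuous_within)
next
  case (Suc k)
  then show ?case by simp
qed

lemma higher_differentiable_on_has_derivative:
  assumes "higher_differentiable_on S f (Suc k)" "x \<in> S"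
  shows "(f has_derivative frechet_derivative f (at x)) (at x)"
  using assms by (simp add: frechet_derivative_works)

lemma higher_differentiable_on_const: "higher_differentiable_on S (\<lambda>x. c) k"
  by (induction k arbitrary: c) auto

lemma higher_differentiable_on_linear:
  assumes "open S" "bounded_linear L" "higher_differentiable_on S f k"
  shows "higher_differentiable_on S (\<lambda>x. L (f x)) k"
  using assms(3)
proof (induction k arbitrary: f)
  case 0
  then show ?case
    using bounded_linear.continuous_on[OF assms(2)] by simp
next
  case (Suc k)
  show ?case
  proof (rule higher_differentiable_on_SucI[OF assms(1)])
    show "((\<lambda>x. L (f x)) has_derivative (\<lambda>v. L (frechet_derivative f (at x) v))) (at x)"
      if "x \<in> S" for x
      using bounded_linear.has_derivative[OF assms(2)]
        higher_differentiable_on_has_derivative[OF Suc.prems that] by blast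
    show "higher_differentiable_on S (\<lambda>x. L (frechet_derivative f (at x) v)) k" for v
      using Suc.prems by (intro Suc.IH) simp
  qed
qed

lemma higher_differentiable_on_add:
  assumes "open S" "higher_differentiable_on S f k" "higher_differentiable_on S g k"
  shows "higher_differentiable_on S (\<lambda>x. f x + g x) k"
  using assms(2,3)
proof (induction k arbitrary: f g)
  case 0
  then show ?case by (auto intro: continuous_on_add)
next
  case (Suc k)
  show ?case
  proof (rule higher_differentiable_on_SucI[OF assms(1)])
    show "((\<lambda>x. f x + g x) has_derivative
        (\<lambda>v. frechet_derivative f (at x) v + frechet_derivative g (at x) v)) (at x)"
      if "x \<in> S" for x
      using Suc.prems that
      by (intro has_derivative_add higher_differentiable_on_has_derivative)
  qed (use Suc in simp)
qed

lemma higher_differentiable_on_sum: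
  assumes "open S" "\<And>i. i \<in> I \<Longrightarrow> higher_differentiable_on S (f i) k"
  shows "higher_differentiable_on S (\<lambda>x. \<Sum>i\<in>I. f i x) k"
  using assms(2)
  by (induction I rule: infinite_finite_induct)
    (auto intro: higher_differentiable_on_const higher_differentiable_on_add[OF assms(1)])

lemma higher_differentiable_on_scaleR:
  fixes c :: "'a::real_normed_vector \<Rightarrow> real" and f :: "'a \<Rightarrow> 'b::real_normed_vector"
  assumes "open S" "higher_differentiable_on S c k" "higher_differentiable_on S f k"
  shows "higher_differentiable_on S (\<lambda>x. c x *\<^sub>R f x) k"
  using assms(2,3)
proof (induction k arbitrary: c f)
  case 0
  then show ?case by (auto intro: continuous_on_scaleR)
next
  case (Suc k)
  show ?case
  proof (rule higher_differentiable_on_SucI[OF assms(1)])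
    show "((\<lambda>x. c x *\<^sub>R f x) has_derivative
        (\<lambda>v. c x *\<^sub>R frechet_derivative f (at x) v + frechet_derivative c (at x) v *\<^sub>R f x)) (at x)"
      if "x \<in> S" for x
      using Suc.prems that
      by (intro has_derivative_scaleR higher_differentiable_on_has_derivative)
    show "higher_differentiable_on S
        (\<lambda>x. c x *\<^sub>R frechet_derivative f (at x) v + frechet_derivative c (at x) v *\<^sub>R f x) k" for v
      using Suc.prems[THEN higher_differentiable_on_SucD] Suc.prems
      by (intro higher_differentiable_on_add[OF assms(1)] Suc.IH) simp_all
  qed
qed

lemma higher_differentiable_on_prod:
  fixes f :: "'i \<Rightarrow> 'a::real_normed_vector \<Rightarrow> real"
  assumes "open S" "\<And>i. i \<in> I \<Longrightarrow> higher_differentiable_on S (f i) k"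
  shows "higher_differentiable_on S (\<lambda>x. \<Prod>i\<in>I. f i x) k"
  using assms(2)
proof (induction I rule: infinite_finite_induct)
  case (insert i I)
  then show ?case
    using higher_differentiable_on_scaleR[OF assms(1), of "f i" k "\<lambda>x. \<Prod>i\<in>I. f i x"]
    by simp
qed (auto intro: higher_differentiable_on_const)

text \<open>The derivative of \<open>1/c\<close> is a polynomial in \<open>1/c\<close> and the derivative of \<open>c\<close>, so the induction
  on the order can use its own hypothesis.\<close>

lemma higher_differentiable_on_inverse:
  fixes c :: "'a::real_normed_vector \<Rightarrow> real"
  assumes "open S" "\<And>x. x \<in> S \<Longrightarrow> c x \<noteq> 0" "higher_differentiable_on S c k"
  shows "higher_differentiable_on S (\<lambda>x. inverse (c x)) k"
  using assms(3)
proof (induction k)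
  case 0
  then show ?case using assms(2) by (auto intro: continuous_on_inverse)
next
  case (Suc k)
  let ?i = "\<lambda>x. inverse (c x)"
  have i: "higher_differentiable_on S ?i k"
    using Suc.IH[OF higher_differentiable_on_SucD[OF Suc.prems]] .
  show ?case
  proof (rule higher_differentiable_on_SucI[OF assms(1)])
    show "(?i has_derivative (\<lambda>v. (- 1) *\<^sub>R ?i x *\<^sub>R ?i x *\<^sub>R frechet_derivative c (at x) v)) (at x)"
      if "x \<in> S" for x
      using Deriv.has_derivative_inverse[OF assms(2)[OF that]
          higher_differentiable_on_has_derivative[OF Suc.prems that]]
      by (simp add: mult.commute[of _ "?i x"])
    show "higher_differentiable_on S (\<lambda>x. (- 1) *\<^sub>R ?i x *\<^sub>R ?i x *\<^sub>R frechet_derivative c (at x) v) k"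
      for v
      using Suc.prems
      by (intro higher_differentiable_on_scaleR[OF assms(1)] higher_differentiable_on_const i) simp
  qed
qed

text \<open>In coordinates the chain rule is a finite sum of products of components of \<open>dg\<close> with
  \<open>\<partial>\<^sub>b f \<circ> g\<close>; the latter is a composition to which the induction hypothesis applies, with
  \<open>\<partial>\<^sub>b f\<close> in place of \<open>f\<close>.\<close>

lemma higher_differentiable_on_compose:
  fixes f :: "'b::euclidean_space \<Rightarrow> 'c::real_normed_vector"
    and g :: "'a::real_normed_vector \<Rightarrow> 'b"
  assumes "open S" "open T" "g ` S \<subseteq> T"
    and "higher_differentiable_on T f k" "higher_differentiable_on S g k"
  shows "higher_differentiable_on S (f \<circ> g) k"
  using assms(4,5)
proof (induction k arbitrary: f)
  case 0
  then show ?case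
    using continuous_on_compose[of S g f] continuous_on_subset[OF _ assms(3), of f] by simp
next
  case (Suc k)
  let ?D = "\<lambda>x v. \<Sum>b\<in>Basis. (frechet_derivative g (at x) v \<bullet> b) *\<^sub>R frechet_derivative f (at (g x)) b"
  show ?case
  proof (rule higher_differentiable_on_SucI[OF assms(1)])
    show "((f \<circ> g) has_derivative ?D x) (at x)" if "x \<in> S" for x
    proof -
      have f': "(f has_derivative frechet_derivative f (at (g x))) (at (g x))"
        using Suc.prems(1) that assms(3) by (intro higher_differentiable_on_has_derivative) auto
      have g': "(g has_derivative frechet_derivative g (at x)) (at x)"
        using Suc.prems(2) that by (rule higher_differentiable_on_has_derivative)
      interpret linear "frechet_derivative f (at (g x))"
        using f' by (rule has_derivative_linear)
      have e: "frechet_derivative f (at (g x)) w = (\<Sum>b\<in>Basis. (w \<bullet> b) *\<^sub>R frechet_derivative f (at (g x)) b)" for w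
        using sum[of "\<lambda>b. (w \<bullet> b) *\<^sub>R b" Basis] by (simp only: euclidean_representation scaleR)
      have "?D x = frechet_derivative f (at (g x)) \<circ> frechet_derivative g (at x)"
        unfolding o_def by (intro ext e[symmetric])
      then show ?thesis
        using diff_chain_at[OF g' f'] by (simp only:)
    qed
    show "higher_differentiable_on S (\<lambda>x. ?D x v) k" for v
    proof (intro higher_differentiable_on_sum higher_differentiable_on_scaleR assms(1))
      fix b :: 'b
      show "higher_differentiable_on S (\<lambda>x. frechet_derivative g (at x) v \<bullet> b) k"
        using Suc.prems(2)
        by (intro higher_differentiable_on_linear[OF assms(1) bounded_linear_inner_left]) simp
      have "higher_differentiable_on S ((\<lambda>y. frechet_derivative f (at y) b) \<circ> g) k"
        using Suc.prems(1) higher_differentiable_on_SucD[OF Suc.prems(2)] by (intro Suc.IH) simp_all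
      then show "higher_differentiable_on S (\<lambda>x. frechet_derivative f (at (g x)) b) k"
        by (simp add: o_def)
    qed
  qed
qed

lemma higher_differentiable_on_det:
  fixes m :: "'a::real_normed_vector \<Rightarrow> 'n \<Rightarrow> 'n::finite \<Rightarrow> real"
  assumes "open S" "\<And>i j. higher_differentiable_on S (\<lambda>x. m x i j) k"
  shows "higher_differentiable_on S (\<lambda>x. det (\<chi> i j. m x i j)) k"
proof -
  have "higher_differentiable_on S (\<lambda>x. of_int (sign p) *\<^sub>R (\<Prod>i\<in>UNIV. m x i (p i))) k" for p
    using assms
    by (intro higher_differentiable_on_scaleR higher_differentiable_on_prod higher_differentiable_on_const)
  then show ?thesis
    unfolding det_def by (intro higher_differentiable_on_sum[OF assms(1)]) simp
qed

lemma higher_differentiable_on_vec: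
  fixes f :: "'a::real_normed_vector \<Rightarrow> 'n::finite \<Rightarrow> real"
  assumes "open S" "\<And>i. higher_differentiable_on S (\<lambda>x. f x i) k"
  shows "higher_differentiable_on S (\<lambda>x. \<chi> i. f x i) k"
proof -
  have "(\<lambda>x. \<chi> i. f x i) = (\<lambda>x. \<Sum>i\<in>UNIV. f x i *\<^sub>R axis i 1)"
    using basis_expansion[of "\<chi> i. f _ i"] by (simp add: scalar_mult_eq_scaleR fun_eq_iff)
  then show ?thesis
    using assms
    by (simp only:) (intro higher_differentiable_on_sum higher_differentiable_on_scaleR
        higher_differentiable_on_const)
qed

lemma smooth_on_differentiable:
  "smooth_on S f \<Longrightarrow> x \<in> S \<Longrightarrow> f differentiable (at x)"
  unfolding smooth_on_def using higher_differentiable_on.simps(2)[of S f 0] by blast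

text \<open>Regularity of the inverse, given that it exists and is continuous. Continuity yields
  differentiability, \<open>dg\<close> at \<open>x\<close> being inverse to \<open>dh\<close> at \<open>g x\<close>. By Cramer's rule it is a rational
  expression in the partial derivatives of \<open>h\<close> composed with \<open>g\<close>, so \<open>dg\<close> is as regular
  as \<open>g\<close>, and the order can be raised by induction.\<close>

theorem smooth_on_right_inverse:
  fixes h :: "real^'n \<Rightarrow> real^'n" and g :: "real^'n \<Rightarrow> real^'n"
  assumes "open X" "open Y" "g ` X \<subseteq> Y" "continuous_on X g" "\<And>x. x \<in> X \<Longrightarrow> h (g x) = x"
    and h: "smooth_on Y h" and inj: "\<And>y. y \<in> Y \<Longrightarrow> inj (frechet_derivative h (at y))"
  shows "smooth_on X g"
proof -
  let ?m = "\<lambda>x. matrix (frechet_derivative h (at (g x)))"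
  \<comment> \<open>Cramer's solution \<open>w\<close> of \<open>dh w = v\<close> at \<open>g x\<close>\<close>
  define C where "C x v = (\<chi> k. det (\<chi> i j. if j = k then v $ i else ?m x $ i $ j) / det (?m x))"
    for x v
  have dh: "(h has_derivative frechet_derivative h (at y)) (at y)" if "y \<in> Y" for y
    using h that higher_differentiable_on_has_derivative[of Y h 0] unfolding smooth_on_def by blast
  have lin: "linear (frechet_derivative h (at y))" if "y \<in> Y" for y
    using dh[OF that] by (rule has_derivative_linear)
  have det: "det (?m x) \<noteq> 0" if "x \<in> X" for x
  proof -
    have "g x \<in> Y" using assms(3) that by blast
    then show ?thesis
      using det_nz_iff_inj[OF lin] inj by blast
  qed
  have cramer: "frechet_derivative h (at (g x)) w = v \<longleftrightarrow> w = C x v" if "x \<in> X" for x v w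
    using cramer[OF det[OF that], of w v] lin[of "g x"] assms(3) that
    unfolding C_def by (auto simp: matrix_works)
  have dg: "(g has_derivative C x) (at x)" if "x \<in> X" for x
  proof (rule has_derivative_inverse_basic[OF dh _ _ _ assms(1) that])
    show "g x \<in> Y" using assms(3) that by blast
    have right: "frechet_derivative h (at (g x)) (C x v) = v" for v
      using cramer[OF that, of "C x v" v] by simp
    have left: "C x (frechet_derivative h (at (g x)) w) = w" for w
      using cramer[OF that, of w "frechet_derivative h (at (g x)) w"] by simp
    show "C x \<circ> frechet_derivative h (at (g x)) = id"
      by (simp add: fun_eq_iff left)
    have "linear (C x)"
    proof (rule linearI)
      show "C x (v + w) = C x v + C x w" for v w
        using left[of "C x v + C x w"] by (simp add: linear_add[OF lin[OF \<open>g x \<in> Y\<close>]] right)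
      show "C x (r *\<^sub>R v) = r *\<^sub>R C x v" for r v
        using left[of "r *\<^sub>R C x v"] by (simp add: linear_scale[OF lin[OF \<open>g x \<in> Y\<close>]] right)
    qed
    then show "bounded_linear (C x)"
      by (rule linear_conv_bounded_linear[THEN iffD1])
    show "continuous (at x) g"
      using assms(1,4) that continuous_on_eq_continuous_at by blast
  qed (use assms(5) in auto)
  have "higher_differentiable_on X g k" for k
  proof (induction k)
    case 0
    then show ?case using assms(4) by simp
  next
    case (Suc k)
    have entry: "higher_differentiable_on X (\<lambda>x. ?m x $ i $ j) k" for i j
    proof -
      have "higher_differentiable_on Y (\<lambda>y. frechet_derivative h (at y) (axis j 1)) k"
        using h higher_differentiable_on.simps(2)[of Y h k] unfolding smooth_on_def by blast
      then have "higher_differentiable_on X ((\<lambda>y. frechet_derivative h (at y) (axis j 1)) \<circ> g) k"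
        by (rule higher_differentiable_on_compose[OF assms(1-3) _ Suc])
      from higher_differentiable_on_linear[OF assms(1) bounded_linear_vec_nth this]
      show ?thesis by (simp add: matrix_def)
    qed
    have d: "higher_differentiable_on X (\<lambda>x. det (?m x)) k"
      using higher_differentiable_on_det[OF assms(1), of "\<lambda>x i j. ?m x $ i $ j", OF entry]
      by simp
    have "higher_differentiable_on X (\<lambda>x. C x v) k" for v
    proof -
      have "higher_differentiable_on X (\<lambda>x. inverse (det (?m x)) *\<^sub>R
          det (\<chi> i j. if j = l then v $ i else ?m x $ i $ j)) k" for l
      proof (intro higher_differentiable_on_scaleR higher_differentiable_on_inverse
            higher_differentiable_on_det assms(1) d det)
        show "higher_differentiable_on X (\<lambda>x. if j = l then v $ i else ?m x $ i $ j) k" for i j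
          using entry by (cases "j = l") (auto intro: higher_differentiable_on_const)
      qed
      then show ?thesis
        unfolding C_def by (intro higher_differentiable_on_vec[OF assms(1)])
          (simp add: divide_inverse mult.commute)
    qed
    then show ?case
      using higher_differentiable_on_SucI[OF assms(1) dg] by blast
  qed
  then show ?thesis by (simp add: smooth_on_def)
qed

lemma onorm_le_sum_Basis:
  fixes T :: "'a::euclidean_space \<Rightarrow> 'b::real_normed_vector"
  assumes "linear T"
  shows "onorm T \<le> (\<Sum>b\<in>Basis. norm (T b))"
proof (rule onorm_le)
  fix v
  have "norm (T v) = norm (\<Sum>b\<in>Basis. (v \<bullet> b) *\<^sub>R T b)"
    using linear_sum[OF assms, of "\<lambda>b. (v \<bullet> b) *\<^sub>R b" Basis]
    by (simp add: euclidean_representation linear_scale[OF assms])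
  also have "\<dots> \<le> (\<Sum>b\<in>Basis. norm v * norm (T b))"
    by (intro sum_norm_le) (simp add: Basis_le_norm mult_right_mono)
  finally show "norm (T v) \<le> (\<Sum>b\<in>Basis. norm (T b)) * norm v"
    by (simp add: sum_distrib_left mult.commute)
qed

text \<open>Pointwise continuity of \<open>x \<mapsto> dh\<^sub>x v\<close> for every \<open>v\<close> amounts to continuity in operator norm,
  because the latter is controlled by the values on a basis.\<close>

lemma smooth_on_locally_injective:
  fixes h :: "'a::euclidean_space \<Rightarrow> 'b::euclidean_space"
  assumes Y: "open Y" "a \<in> Y" and h: "smooth_on Y h" and inj: "inj (frechet_derivative h (at a))"
  obtains r where "r > 0" "ball a r \<subseteq> Y" "inj_on h (ball a r)"
proof -
  let ?D = "\<lambda>x. frechet_derivative h (at x)"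
  have D: "(h has_derivative ?D x) (at x)" if "x \<in> Y" for x
    using smooth_on_differentiable[OF h that] by (simp add: frechet_derivative_works)
  obtain g' where g': "linear g'" "g' \<circ> ?D a = id"
    using linear_injective_left_inverse[OF has_derivative_linear[OF D[OF Y(2)]] inj] by blast
  have cont: "continuous_on Y (\<lambda>x. ?D x v)" for v
    using h higher_differentiable_on.simps(2)[of Y h 0] unfolding smooth_on_def higher_differentiable_on.simps(1)
    by blast
  have small: "\<exists>d>0. \<forall>x. dist a x < d \<longrightarrow> onorm (\<lambda>v. ?D x v - ?D a v) < e" if "e > 0" for e
  proof -
    let ?s = "\<lambda>x. \<Sum>b\<in>Basis. norm (?D x b - ?D a b)"
    have "continuous_on Y ?s"
      by (intro continuous_intros cont)
    then have "open (Y \<inter> ?s -` {..<e})"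
      using Y(1) by (intro continuous_open_preimage) auto
    moreover have "a \<in> Y \<inter> ?s -` {..<e}" using Y(2) \<open>e > 0\<close> by simp
    ultimately obtain d where d: "d > 0" "ball a d \<subseteq> Y \<inter> ?s -` {..<e}"
      by (meson openE)
    have "onorm (\<lambda>v. ?D x v - ?D a v) < e" if "dist a x < d" for x
    proof -
      have x: "x \<in> Y" "?s x < e" using d(2) that by (auto simp: subset_iff)
      have "linear (\<lambda>v. ?D x v - ?D a v)"
        using D x(1) Y(2) by (intro linear_compose_sub has_derivative_linear)
      from onorm_le_sum_Basis[OF this] show ?thesis using x(2) by simp
    qed
    then show ?thesis using d(1) by blast
  qed
  show ?thesis
    using has_derivative_locally_injective[OF Y(2,1) linear_conv_bounded_linear[THEN iffD1, OF g'(1)]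
        g'(2) D small] that by blast
qed

section \<open>Local homeomorphisms onto simply connected spaces\<close>

definition local_homeomorphism ::
    "'a::topological_space set \<Rightarrow> 'b::topological_space set \<Rightarrow> ('a \<Rightarrow> 'b) \<Rightarrow> bool" where
  "local_homeomorphism C S p \<longleftrightarrow> (\<forall>x\<in>C. \<exists>U V q. x \<in> U \<and> openin (top_of_set C) U \<and>
     openin (top_of_set S) V \<and> homeomorphism U V p q)"

lemma local_homeomorphismE:
  assumes "local_homeomorphism C S p" "x \<in> C"
  obtains U V q where "x \<in> U" "openin (top_of_set C) U" "openin (top_of_set S) V"
    "homeomorphism U V p q"
  using assms unfolding local_homeomorphism_def by blast

lemma local_homeomorphism_continuous_on:
  assumes "local_homeomorphism C S p"
  shows "continuous_on C p"
  unfolding continuous_on_def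
proof (rule ballI)
  fix x assume "x \<in> C"
  then obtain U V q where U: "x \<in> U" "openin (top_of_set C) U" "openin (top_of_set S) V"
        "homeomorphism U V p q"
    by (rule local_homeomorphismE[OF assms])
  obtain T where T: "open T" "U = C \<inter> T"
    using U(2) by (auto simp: openin_open)
  have "(p \<longlongrightarrow> p x) (at x within U)"
    using homeomorphism_cont1[OF U(4)] U(1) by (simp add: continuous_on_def)
  then show "(p \<longlongrightarrow> p x) (at x within C)"
    using at_within_nhd[of x T U C] T U(1) by auto
qed

text \<open>The image is open as well as compact.\<close>

lemma local_homeomorphism_image:
  fixes p :: "'a::topological_space \<Rightarrow> 'b::t2_space"
  assumes "local_homeomorphism C S p" "compact C" "C \<noteq> {}" "connected S"
  shows "p ` C = S"
proof -
  have sub: "p ` C \<subseteq> S"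
  proof clarify
    fix x assume "x \<in> C"
    then obtain U V q where U: "x \<in> U" "openin (top_of_set C) U" "openin (top_of_set S) V"
        "homeomorphism U V p q"
      by (rule local_homeomorphismE[OF assms(1)])
    then have "p x \<in> V" "V \<subseteq> S"
      using homeomorphism_image1[OF U(4)] openin_imp_subset[OF U(3)] U(1) by blast+
    then show "p x \<in> S" by blast
  qed
  have "openin (top_of_set S) (p ` C)"
  proof (subst openin_subopen, clarify)
    fix x assume "x \<in> C"
    then obtain U V q where U: "x \<in> U" "openin (top_of_set C) U" "openin (top_of_set S) V"
        "homeomorphism U V p q"
      by (rule local_homeomorphismE[OF assms(1)])
    then have "p ` U = V" "U \<subseteq> C"
      by (auto simp: homeomorphism_def openin_imp_subset)
    then show "\<exists>V. openin (top_of_set S) V \<and> p x \<in> V \<and> V \<subseteq> p ` C"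
      using U by blast
  qed
  moreover have "closedin (top_of_set S) (p ` C)"
    using local_homeomorphism_continuous_on[OF assms(1)] assms(2) sub
    by (simp add: closed_subset compact_continuous_image compact_imp_closed)
  ultimately show ?thesis
    using assms(3,4) unfolding connected_clopen by blast
qed

text \<open>Local injectivity makes the fibre discrete, and it is compact.\<close>

lemma finite_fibre:
  fixes p :: "'a::topological_space \<Rightarrow> 'b::t1_space"
  assumes "local_homeomorphism C S p" "compact C"
  shows "finite (C \<inter> p -` {y})"
proof -
  let ?F = "C \<inter> p -` {y}"
  have "closedin (top_of_set C) ?F"
    using local_homeomorphism_continuous_on[OF assms(1)]
    by (intro continuous_closedin_preimage) auto
  then have "compact ?F"
    using assms(2) closedin_compact by blast
  moreover have "openin (top_of_set ?F) c" if "c \<in> (\<lambda>x. {x}) ` ?F" for c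
  proof -
    obtain x where x: "c = {x}" "x \<in> C" "p x = y" using \<open>c \<in> _\<close> by auto
    obtain U V q where U: "x \<in> U" "openin (top_of_set C) U" "openin (top_of_set S) V"
        "homeomorphism U V p q"
      using local_homeomorphismE[OF assms(1) x(2)] by blast
    have "z = x" if "z \<in> U" "p z = y" for z
      using U that x by (metis homeomorphism_apply1)
    then have "{x} = ?F \<inter> U" using x U(1) by blast
    moreover obtain T where "open T" "U = C \<inter> T" using U(2) by (auto simp: openin_open)
    ultimately show ?thesis using x by (auto simp: openin_open intro!: exI[of _ T])
  qed
  moreover have "?F \<subseteq> \<Union>((\<lambda>x. {x}) ` ?F)" by blast
  ultimately obtain D where "D \<subseteq> (\<lambda>x. {x}) ` ?F" "finite D" "?F \<subseteq> \<Union>D"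
    using compact_eq_openin_cover[of ?F, THEN iffD1, rule_format, of "(\<lambda>x. {x}) ` ?F"] by blast
  moreover from this have "finite (\<Union>D)"
    by (intro finite_Union) auto
  ultimately show ?thesis
    by (metis finite_subset)
qed

text \<open>A fibre is finite, so its points have disjoint neighbourhoods \<open>W x\<close> on which \<open>p\<close> is a
  homeomorphism. The common image of these neighbourhoods need not be evenly covered, as further
  points of \<open>C\<close> may lie over it; but those points form a subset of the compact set
  \<open>R = C - \<Union>W x\<close>, whose image is closed and misses \<open>y\<close>, so that it can be removed.\<close>

lemma local_homeomorphism_covering_space:
  fixes p :: "'a::metric_space \<Rightarrow> 'b::t2_space"
  assumes lh: "local_homeomorphism C S p" and C: "compact C" "C \<noteq> {}" and S: "connected S"
  shows "covering_space C p S"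
proof
  show cont: "continuous_on C p"
    using lh by (rule local_homeomorphism_continuous_on)
  show img: "p ` C = S"
    using assms by (intro local_homeomorphism_image)
  fix y assume "y \<in> S"
  define F where "F = C \<inter> p -` {y}"
  have finF: "finite F"
    unfolding F_def using lh C(1) by (rule finite_fibre)
  obtain d where d: "d > 0" "\<And>x x'. x \<in> F \<Longrightarrow> x' \<in> F \<Longrightarrow> x \<noteq> x' \<Longrightarrow> d \<le> dist x x'"
  proof -
    \<comment> \<open>A finite set of reals, here that of all pairwise distances, has no nonzero element near \<open>0\<close>.\<close>
    have "finite ((\<lambda>(x, x'). dist x x') ` (F \<times> F))"
      using finF by simp
    from finite_set_avoid[OF this, of 0] show ?thesis
      using that by fastforce
  qed
  have "\<exists>W q. x \<in> W \<and> openin (top_of_set C) W \<and> openin (top_of_set S) (p ` W) \<and>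
      homeomorphism W (p ` W) p q \<and> W \<subseteq> ball x (d/2)" if "x \<in> F" for x
  proof -
    obtain U V q where U: "x \<in> U" "openin (top_of_set C) U" "openin (top_of_set S) V"
        "homeomorphism U V p q"
      using local_homeomorphismE[OF lh, of x] \<open>x \<in> F\<close> unfolding F_def by blast
    let ?W = "U \<inter> ball x (d/2)"
    have "openin (top_of_set U) ?W" by blast
    then have "openin (top_of_set V) (p ` ?W)"
      using U(4) by (rule homeomorphism_imp_open_map[rotated])
    then have "openin (top_of_set S) (p ` ?W)"
      using U(3) openin_trans by blast
    moreover have "homeomorphism ?W (p ` ?W) p q"
      using U(4) by (rule homeomorphism_of_subsets) (use U(4) in \<open>auto simp: homeomorphism_def\<close>)
    moreover have "openin (top_of_set C) ?W"
      using U(2) by (simp add: openin_Int_open)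
    moreover have "x \<in> ?W" using U(1) d(1) by simp
    ultimately show ?thesis by blast
  qed
  then obtain W q where W: "\<And>x. x \<in> F \<Longrightarrow> x \<in> W x \<and> openin (top_of_set C) (W x) \<and>
      openin (top_of_set S) (p ` W x) \<and> homeomorphism (W x) (p ` W x) p (q x) \<and> W x \<subseteq> ball x (d/2)"
    by metis
  define R where "R = C - (\<Union>x\<in>F. W x)"
  define T where "T = (S \<inter> (\<Inter>x\<in>F. p ` W x)) \<inter> (S - p ` R)"
  have "openin (top_of_set C) (\<Union>x\<in>F. W x)"
    using W by (intro openin_Union) blast
  then have "closedin (top_of_set C) R"
    unfolding R_def by (intro closedin_diff) auto
  then have "compact R"
    using C(1) closedin_compact by blast
  then have "closed (p ` R)"
    using cont unfolding R_def by (meson Diff_subset compact_continuous_image compact_imp_closed continuous_on_subset)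
  then have "openin (top_of_set S) (S - p ` R)"
    by (simp add: Diff_eq open_Compl openin_open_Int)
  moreover have "openin (top_of_set S) (S \<inter> (\<Inter>x\<in>F. p ` W x))"
    using openin_INT[OF finF, of "top_of_set S" "\<lambda>x. p ` W x"] W by (simp add: Int_commute)
  ultimately have oT: "openin (top_of_set S) T"
    unfolding T_def by blast
  have yT: "y \<in> T"
    using \<open>y \<in> S\<close> W unfolding T_def R_def F_def by force
  let ?v = "(\<lambda>x. W x \<inter> p -` T) ` F"
  have WC: "W x \<subseteq> C" if "x \<in> F" for x
    using W[OF that] openin_imp_subset by blast
  have "\<Union>?v = C \<inter> p -` T"
    using WC unfolding T_def R_def by auto
  moreover have "openin (top_of_set C) u" if "u \<in> ?v" for u
  proof -
    obtain x where x: "x \<in> F" "u = W x \<inter> p -` T" using \<open>u \<in> ?v\<close> by blast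
    have "openin (top_of_set C) (C \<inter> p -` T)"
      using cont img oT by (intro continuous_openin_preimage) auto
    then have "openin (top_of_set C) (W x \<inter> (C \<inter> p -` T))"
      using W[OF x(1)] by blast
    moreover have "W x \<inter> (C \<inter> p -` T) = u" using WC[OF x(1)] x(2) by blast
    ultimately show ?thesis by simp
  qed
  moreover have "pairwise disjnt ?v"
  proof -
    have "W x \<inter> W x' = {}" if "x \<in> F" "x' \<in> F" "x \<noteq> x'" for x x'
    proof (rule ccontr)
      assume "W x \<inter> W x' \<noteq> {}"
      then obtain z where "z \<in> W x" "z \<in> W x'" by blast
      then have "dist x z < d/2" "dist x' z < d/2"
        using W that by (meson mem_ball subsetD)+
      then have "dist x x' < d"
        using dist_triangle_half_l[of x z d x'] by (simp add: dist_commute)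
      then show False using d(2)[OF that] by simp
    qed
    then show ?thesis
      unfolding pairwise_def disjnt_def by blast
  qed
  moreover have "\<exists>q. homeomorphism u T p q" if "u \<in> ?v" for u
  proof -
    obtain x where x: "x \<in> F" "u = W x \<inter> p -` T" using \<open>u \<in> ?v\<close> by blast
    have "homeomorphism u T p (q x)"
    proof (rule homeomorphism_of_subsets)
      show "homeomorphism (W x) (p ` W x) p (q x)" using W[OF x(1)] by blast
      show Tsub: "T \<subseteq> p ` W x" using x(1) unfolding T_def by blast
      show "p ` u = T" using Tsub unfolding x(2) by blast
    qed (use x in blast)
    then show ?thesis by blast
  qed
  ultimately show "\<exists>T. y \<in> T \<and> openin (top_of_set S) T \<and> (\<exists>v. \<Union>v = C \<inter> p -` T \<and>
      (\<forall>u\<in>v. openin (top_of_set C) u) \<and> pairwise disjnt v \<and> (\<forall>u\<in>v. \<exists>q. homeomorphism u T p q))"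
    using yT oT by (intro exI[of _ T] exI[of _ ?v] conjI) auto
qed

text \<open>Lifting the identity of \<open>S\<close> gives a section \<open>g\<close>. Its image is the set where \<open>g \<circ> p\<close> is the
  identity. This set is closed, and it is open because \<open>g \<circ> p\<close> preserves fibres while \<open>p\<close> is locally
  injective. So \<open>g\<close> inverts \<open>p\<close> on all of the connected set \<open>C\<close>.\<close>

lemma covering_space_simply_connected_inj_on:
  fixes p :: "'a::real_normed_vector \<Rightarrow> 'b::real_normed_vector"
  assumes cov: "covering_space C p S" and C: "connected C"
    and S: "simply_connected S" "locally path_connected S"
  shows "inj_on p C"
proof (cases "C = {}")
  case False
  have cont: "continuous_on C p" and img: "p ` C = S"
    using cov by (simp_all add: covering_space_def)
  obtain g where g: "continuous_on S g" "g \<in> S \<rightarrow> C" "\<And>y. y \<in> S \<Longrightarrow> p (g y) = y"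
    using covering_space_lift[OF cov S continuous_on_id] by auto
  let ?E = "{x \<in> C. g (p x) = x}"
  have gp: "continuous_on C (\<lambda>x. g (p x))"
    using continuous_on_compose2[OF g(1) cont] img by blast
  have "closedin (top_of_set C) ?E"
    using continuous_closedin_preimage_constant[OF continuous_on_diff[OF gp continuous_on_id], of 0]
    by simp
  moreover have "openin (top_of_set C) ?E"
  proof (subst openin_subopen, intro ballI)
    fix x assume x: "x \<in> ?E"
    obtain u T q where u: "x \<in> u" "openin (top_of_set C) u" "homeomorphism u T p q"
      using covering_space_local_homeomorphism[OF cov, of x] x by (metis (no_types, lifting) mem_Collect_eq)
    let ?u = "u \<inter> (C \<inter> (\<lambda>x. g (p x)) -` u)"
    have "(\<lambda>x. g (p x)) \<in> C \<rightarrow> C" using g(2) img by auto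
    then have "openin (top_of_set C) ?u"
      using u(2) continuous_openin_preimage[OF gp _ u(2)] by blast
    moreover have "?u \<subseteq> ?E"
    proof
      fix z assume z: "z \<in> ?u"
      then have "p z \<in> S" using img by blast
      then have "q (p (g (p z))) = q (p z)" using g(3) by simp
      then show "z \<in> ?E"
        using z homeomorphism_apply1[OF u(3), of z] homeomorphism_apply1[OF u(3), of "g (p z)"] by simp
    qed
    moreover have "x \<in> ?u" using x u(1) by auto
    ultimately show "\<exists>T. openin (top_of_set C) T \<and> x \<in> T \<and> T \<subseteq> ?E" by blast
  qed
  moreover have "?E \<noteq> {}"
  proof -
    obtain x where "x \<in> C" using False by blast
    then have "p x \<in> S" using img by blast
    then have "g (p x) \<in> ?E" using g(2,3) by auto
    then show ?thesis by blast
  qed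
  ultimately have "?E = C"
    using C unfolding connected_clopen by blast
  then show ?thesis by (metis (mono_tags, lifting) inj_onI mem_Collect_eq)
qed simp

lemma apply_bcontfun_sum:
  fixes f :: "'i \<Rightarrow> ('a::topological_space \<Rightarrow>\<^sub>C 'b::real_normed_vector)"
  shows "apply_bcontfun (\<Sum>i\<in>I. f i) x = (\<Sum>i\<in>I. apply_bcontfun (f i) x)"
  by (induction I rule: infinite_finite_induct) simp_all

text \<open>All functions of a finite family are encoded in one map to a normed space. The number of
  functions is arbitrary, so the target is the space of bounded real sequences instead of
  some \<open>\<real>\<^sup>n\<close>, whose dimension would have to be a type.\<close>

lemma exists_bcontfun_separating:
  fixes b :: "'a::topological_space \<Rightarrow> 'a \<Rightarrow> real"
  assumes "finite A" "\<And>a. a \<in> A \<Longrightarrow> continuous_on C (b a)"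
  obtains F :: "'a \<Rightarrow> (nat \<Rightarrow>\<^sub>C real)"
  where "continuous_on C F" "\<And>x y a. F x = F y \<Longrightarrow> a \<in> A \<Longrightarrow> b a x = b a y"
proof
  define e :: "nat \<Rightarrow> (nat \<Rightarrow>\<^sub>C real)" where "e i = Bcontfun (\<lambda>j. if j = i then 1 else 0)" for i
  have e: "apply_bcontfun (e i) j = (if j = i then 1 else 0)" for i j
    unfolding e_def
  proof (subst Bcontfun_inverse)
    have "bounded (range (\<lambda>j. if j = i then 1 else (0::real)))"
      by (rule bounded_subset[of "{0, 1}"]) auto
    then show "(\<lambda>j. if j = i then 1 else (0::real)) \<in> bcontfun"
      unfolding bcontfun_def by (intro CollectI conjI) simp_all
  qed simp
  define F where "F x = (\<Sum>a\<in>A. b a x *\<^sub>R e (to_nat_on A a))" for x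
  have F: "apply_bcontfun (F x) (to_nat_on A a) = b a x" if "a \<in> A" for a x
  proof -
    have "apply_bcontfun (F x) (to_nat_on A a) = (\<Sum>a'\<in>A. if a' = a then b a x else 0)"
      unfolding F_def apply_bcontfun_sum
      by (intro sum.cong) (auto simp: e that assms(1) countable_finite)
    then show ?thesis using assms(1) that by simp
  qed
  show "continuous_on C F"
    unfolding F_def using assms(2) by (intro continuous_on_sum continuous_on_scaleR) auto
  show "b a x = b a y" if "F x = F y" "a \<in> A" for x y a
    using F[OF that(2), of x] F[OF that(2), of y] that(1) by simp
qed

text \<open>The bump function is a cone over a small ball of \<open>S\<close>, pulled back to a neighbourhood \<open>U\<close> of \<open>a\<close>
  that is homeomorphic to its image, and extended by \<open>0\<close>. The extension is continuous because the
  part of \<open>U\<close> over the closed ball is compact, hence closed in the Hausdorff space.\<close>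

lemma local_homeomorphism_bump:
  fixes p :: "'a::t2_space \<Rightarrow> 'b::metric_space"
  assumes "local_homeomorphism C S p" "compact S" "a \<in> C"
  obtains b :: "'a \<Rightarrow> real" where "continuous_on C b" "b a > 0" "inj_on p {x \<in> C. b x > 0}"
proof -
  obtain U V q where U: "a \<in> U" "openin (top_of_set C) U" "openin (top_of_set S) V"
      "homeomorphism U V p q"
    by (rule local_homeomorphismE[OF assms(1,3)])
  have pU: "p ` U = V" "\<And>x. x \<in> U \<Longrightarrow> q (p x) = x"
    using U(4) by (auto simp: homeomorphism_def)
  have "p a \<in> V" using U(1) pU by blast
  then obtain r where r: "r > 0" "cball (p a) r \<inter> S \<subseteq> V" "V \<subseteq> S"
    using U(3) unfolding openin_contains_cball by blast
  define K where "K = q ` (cball (p a) r \<inter> S)"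
  have "compact K"
    unfolding K_def
  proof (rule compact_continuous_image)
    show "continuous_on (cball (p a) r \<inter> S) q"
      using U(4) r(2) continuous_on_subset homeomorphism_cont2 by blast
    show "compact (cball (p a) r \<inter> S)"
      using assms(2) by (simp add: closed_Int_compact)
  qed
  have KU: "K \<subseteq> U"
    using r(2) homeomorphism_image2[OF U(4)] unfolding K_def by blast
  have out: "dist (p x) (p a) > r" if "x \<in> U" "x \<notin> K" for x
  proof (rule ccontr)
    assume "\<not> ?thesis"
    then have "p x \<in> cball (p a) r \<inter> S"
      using pU r(3) that(1) by (auto simp: dist_commute)
    then have "q (p x) \<in> K" unfolding K_def by blast
    then show False using pU that by simp
  qed
  have UC: "U \<subseteq> C" using U(2) by (rule openin_imp_subset)
  define b where "b x = (if x \<in> U then max 0 (r - dist (p x) (p a)) else 0)" for x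
  have "C = U \<union> (C - K)" using KU UC by blast
  moreover have "continuous_on (U \<union> (C - K)) b"
    unfolding b_def
  proof (rule continuous_on_cases_local_open)
    show "openin (top_of_set (U \<union> (C - K))) U"
      using U(2) calculation by simp
    have "openin (top_of_set C) (C - K)"
      using \<open>compact K\<close> by (simp add: Diff_eq compact_imp_closed open_Compl openin_open_Int)
    then show "openin (top_of_set (U \<union> (C - K))) (C - K)"
      using calculation by simp
    show "continuous_on U (\<lambda>x. max 0 (r - dist (p x) (p a)))"
      using homeomorphism_cont1[OF U(4)] by (intro continuous_intros)
    show "max 0 (r - dist (p x) (p a)) = 0" if "x \<in> U \<and> x \<notin> U \<or> x \<in> C - K \<and> x \<in> U" for x
      using out[of x] that by auto
  qed auto
  ultimately have "continuous_on C b" by simp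
  moreover have "b a > 0" using r(1) U(1) by (simp add: b_def)
  moreover have "inj_on p {x \<in> C. b x > 0}"
    by (rule inj_onI) (metis (mono_tags, lifting) b_def less_irrefl mem_Collect_eq pU(2))
  ultimately show ?thesis using that by blast
qed

text \<open>The sets on which the bump functions are positive form an open cover, and finitely many of them
  suffice. If two points agree under \<open>p\<close> and under these functions, they lie in a common set of the
  cover, on which \<open>p\<close> is injective.\<close>

lemma local_homeomorphism_embedding:
  fixes p :: "'a::t2_space \<Rightarrow> 'b::metric_space"
  assumes lh: "local_homeomorphism C S p" and "compact C" "compact S"
  obtains F :: "'a \<Rightarrow> (nat \<Rightarrow>\<^sub>C real)" where "continuous_on C F" "inj_on (\<lambda>x. (p x, F x)) C"
proof -
  obtain b :: "'a \<Rightarrow> 'a \<Rightarrow> real" where b: "\<And>a. a \<in> C \<Longrightarrow> continuous_on C (b a)"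
      "\<And>a. a \<in> C \<Longrightarrow> b a a > 0" "\<And>a. a \<in> C \<Longrightarrow> inj_on p {x \<in> C. b a x > 0}"
  proof -
    have "\<forall>a\<in>C. \<exists>b. continuous_on C b \<and> b a > (0::real) \<and> inj_on p {x \<in> C. b x > 0}"
      using local_homeomorphism_bump[OF lh assms(3)] by (intro ballI) blast
    then show ?thesis using that by metis
  qed
  let ?B = "\<lambda>a. {x \<in> C. b a x > 0}"
  have "openin (top_of_set C) (?B a)" if "a \<in> C" for a
  proof -
    have "?B a = C \<inter> b a -` {0<..}" by auto
    then show ?thesis
      using continuous_openin_preimage_gen[OF b(1)[OF that], of "{0<..}"] by simp
  qed
  moreover have "C \<subseteq> \<Union>(?B ` C)" using b(2) by blast
  ultimately obtain D where "D \<subseteq> ?B ` C" "finite D" "C \<subseteq> \<Union>D"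
    using assms(2)[unfolded compact_eq_openin_cover, rule_format, of "?B ` C"] by blast
  moreover from this obtain A where "A \<subseteq> C" "finite A" "D = ?B ` A"
    using finite_subset_image[of D ?B C] by blast
  ultimately have A: "A \<subseteq> C" "finite A" "C \<subseteq> \<Union>(?B ` A)"
    by simp_all
  obtain F :: "'a \<Rightarrow> (nat \<Rightarrow>\<^sub>C real)" where F: "continuous_on C F"
      "\<And>x y a. F x = F y \<Longrightarrow> a \<in> A \<Longrightarrow> b a x = b a y"
    using exists_bcontfun_separating[OF A(2), of C b] b(1) A(1) by blast
  have "inj_on (\<lambda>x. (p x, F x)) C"
  proof (rule inj_onI)
    fix x y assume xy: "x \<in> C" "y \<in> C" "(p x, F x) = (p y, F y)"
    obtain a where a: "a \<in> A" "b a x > 0" using A(3) xy(1) by blast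
    then have "b a y > 0" using F(2)[of x y a] xy(3) by simp
    then show "x = y"
      using b(3)[of a] A(1) a xy unfolding inj_on_def by blast
  qed
  then show ?thesis using that F(1) by blast
qed

text \<open>The embedding above turns \<open>p\<close> into the first projection of a product of normed spaces,
  restricted to a compact connected set. There it is a covering, and lifts exist.\<close>

theorem local_homeomorphism_simply_connected_bij_betw:
  fixes p :: "'a::t2_space \<Rightarrow> 'b::real_normed_vector"
  assumes lh: "local_homeomorphism C S p" and C: "compact C" "connected C" "C \<noteq> {}"
    and S: "compact S" "simply_connected S" "locally path_connected S"
  shows "bij_betw p C S"
proof -
  obtain F :: "'a \<Rightarrow> (nat \<Rightarrow>\<^sub>C real)" where F: "continuous_on C F" "inj_on (\<lambda>x. (p x, F x)) C"
    using local_homeomorphism_embedding[OF lh C(1) S(1)] by blast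
  let ?G = "\<lambda>x. (p x, F x)"
  let ?C = "?G ` C"
  have contG: "continuous_on C ?G"
    using F(1) local_homeomorphism_continuous_on[OF lh] by (intro continuous_on_Pair)
  then obtain G' where G': "homeomorphism C ?C ?G G'"
    using homeomorphism_compact[OF C(1) _ refl F(2)] by blast
  have "local_homeomorphism ?C S fst"
    unfolding local_homeomorphism_def
  proof (intro ballI)
    fix z assume "z \<in> ?C"
    then obtain x where x: "x \<in> C" "z = ?G x" by blast
    obtain U V q where U: "x \<in> U" "openin (top_of_set C) U" "openin (top_of_set S) V"
        "homeomorphism U V p q"
      by (rule local_homeomorphismE[OF lh x(1)])
    have UC: "U \<subseteq> C" using U(2) by (rule openin_imp_subset)
    have "homeomorphism (?G ` U) V fst (?G \<circ> q)"
      unfolding homeomorphism_def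
    proof (intro conjI)
      show "continuous_on V (?G \<circ> q)"
        using homeomorphism_cont2[OF U(4)] continuous_on_subset[OF contG UC] homeomorphism_image2[OF U(4)]
        by (intro continuous_on_compose) simp_all
    qed (use U(4) in \<open>auto simp: homeomorphism_def image_image intro!: continuous_intros\<close>)
    moreover have "openin (top_of_set ?C) (?G ` U)"
      using G' U(2) by (rule homeomorphism_imp_open_map)
    ultimately show "\<exists>U V q. z \<in> U \<and> openin (top_of_set ?C) U \<and> openin (top_of_set S) V \<and>
        homeomorphism U V fst q"
      using x U(1,3) by (intro exI[of _ "?G ` U"] exI[of _ V] exI[of _ "?G \<circ> q"] conjI) simp_all
  qed
  moreover have "compact ?C" "connected ?C"
    using contG C by (auto intro: compact_continuous_image connected_continuous_image)
  ultimately have "covering_space ?C fst S"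
    using C(3) S(2)
    by (intro local_homeomorphism_covering_space) (auto intro: simply_connected_imp_connected)
  then have "inj_on fst ?C"
    using \<open>connected ?C\<close> S by (intro covering_space_simply_connected_inj_on)
  then have "inj_on (fst \<circ> ?G) C"
    using F(2) by (rule comp_inj_on[rotated])
  then have "inj_on p C" by (simp add: o_def)
  moreover have "p ` C = S"
    using lh C S by (intro local_homeomorphism_image) (auto intro: simply_connected_imp_connected)
  ultimately show ?thesis by (simp add: bij_betw_def)
qed

section \<open>Differentials in charts\<close>

lemma is_chartD:
  assumes "is_chart M (U, \<phi>)"
  shows "openin (top_of_set M) U" "open (\<phi> ` U)" "homeomorphism U (\<phi> ` U) \<phi> (inv_into U \<phi>)"
  using assms by (simp_all add: is_chart_def)

lemma chart_inv_into:
  assumes "is_chart M (U, \<phi>)" "p \<in> U"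
  shows "inv_into U \<phi> (\<phi> p) = p"
  using homeomorphism_apply1[OF is_chartD(3)[OF assms(1)] assms(2)] .

lemma open_chart_image:
  assumes "is_chart M (U, \<phi>)" "openin (top_of_set M) W"
  shows "open (\<phi> ` (U \<inter> W))"
proof -
  have "U \<subseteq> M" using is_chartD(1)[OF assms(1)] by (rule openin_imp_subset)
  then have "openin (top_of_set U) (U \<inter> W)"
    using openin_subtopology_Int2[OF assms(2), of U] by (simp add: Int_absorb2 subtopology_subtopology Int_absorb1)
  then have "openin (top_of_set (\<phi> ` U)) (\<phi> ` (U \<inter> W))"
    using homeomorphism_imp_open_map is_chartD(3)[OF assms(1)] by blast
  then show ?thesis
    using is_chartD(2)[OF assms(1)] openin_open_eq by blast
qed

text \<open>The differential of the transition map does not depend on the function \<open>g\<close>. This is what makes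
  tangent planes and tangent differentials independent of the chart.\<close>

lemma frechet_derivative_change_of_chart:
  assumes U: "is_chart M (U, \<phi>)" and V: "is_chart M (V, \<psi>)" and p: "p \<in> U" "p \<in> V"
    and T: "(\<phi> \<circ> inv_into V \<psi>) differentiable (at (\<psi> p))"
    and g: "(g \<circ> inv_into U \<phi>) differentiable (at (\<phi> p))"
  shows "frechet_derivative (g \<circ> inv_into V \<psi>) (at (\<psi> p)) =
    frechet_derivative (g \<circ> inv_into U \<phi>) (at (\<phi> p)) \<circ>
    frechet_derivative (\<phi> \<circ> inv_into V \<psi>) (at (\<psi> p))"
proof -
  let ?X = "\<psi> ` (V \<inter> U)"
  have "frechet_derivative (g \<circ> inv_into V \<psi>) (at (\<psi> p)) =
      frechet_derivative ((g \<circ> inv_into U \<phi>) \<circ> (\<phi> \<circ> inv_into V \<psi>)) (at (\<psi> p))"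
  proof (rule frechet_derivative_cong_open)
    show "open ?X" using V is_chartD(1)[OF U] by (rule open_chart_image)
    show "\<psi> p \<in> ?X" using p by blast
    show "(g \<circ> inv_into V \<psi>) y = ((g \<circ> inv_into U \<phi>) \<circ> (\<phi> \<circ> inv_into V \<psi>)) y" if "y \<in> ?X" for y
      using that chart_inv_into[OF U] chart_inv_into[OF V] by auto
  qed
  also have "\<dots> = frechet_derivative (g \<circ> inv_into U \<phi>) (at (\<phi> p)) \<circ>
      frechet_derivative (\<phi> \<circ> inv_into V \<psi>) (at (\<psi> p))"
    using frechet_derivative_compose[of "\<phi> \<circ> inv_into V \<psi>" "\<psi> p" "g \<circ> inv_into U \<phi>"] T g
    by (simp add: chart_inv_into[OF V p(2)])
  finally show ?thesis .
qed

lemma smooth_atlas_chart: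
  "smooth_atlas M A \<Longrightarrow> c \<in> A \<Longrightarrow> is_chart M c"
  by (simp add: smooth_atlas_def)

lemma smooth_atlas_transition:
  assumes "smooth_atlas M A" "(U, \<phi>) \<in> A" "(V, \<psi>) \<in> A" "p \<in> U" "p \<in> V"
  shows "(\<psi> \<circ> inv_into U \<phi>) differentiable (at (\<phi> p))"
proof -
  have "smooth_on (\<phi> ` (U \<inter> V)) (\<psi> \<circ> inv_into U \<phi>)"
    using assms(1-3) unfolding smooth_atlas_def by fast
  then show ?thesis
    using assms(4,5) by (intro smooth_on_differentiable) auto
qed

lemma immersed_surface_chart:
  assumes "immersed_surface M A f" "(U, \<phi>) \<in> A" "p \<in> U"
  shows "is_chart M (U, \<phi>)" "(f \<circ> inv_into U \<phi>) differentiable (at (\<phi> p))"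
    "inj (frechet_derivative (f \<circ> inv_into U \<phi>) (at (\<phi> p)))"
proof -
  show c: "is_chart M (U, \<phi>)"
    using assms(1,2) smooth_atlas_chart unfolding immersed_surface_def by blast
  have "smooth_on (\<phi> ` (U \<inter> M)) (f \<circ> inv_into U \<phi>)"
    using assms(1,2) unfolding immersed_surface_def smooth_fun_def by fast
  then show "(f \<circ> inv_into U \<phi>) differentiable (at (\<phi> p))"
    using assms(3) openin_imp_subset[OF is_chartD(1)[OF c]] by (intro smooth_on_differentiable) auto
  show "inj (frechet_derivative (f \<circ> inv_into U \<phi>) (at (\<phi> p)))"
    using assms unfolding immersed_surface_def by fast
qed

lemma tangent_plane_chart:
  assumes "immersed_surface M A f" "(U, \<phi>) \<in> A" "p \<in> U"
  shows "tangent_plane A f p = range (frechet_derivative (f \<circ> inv_into U \<phi>) (at (\<phi> p)))"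
proof -
  have at: "smooth_atlas M A" using assms(1) by (simp add: immersed_surface_def)
  have "range (frechet_derivative (f \<circ> inv_into V \<psi>) (at (\<psi> p))) \<subseteq>
      range (frechet_derivative (f \<circ> inv_into U \<phi>) (at (\<phi> p)))" if "(V, \<psi>) \<in> A" "p \<in> V" for V \<psi>
    unfolding frechet_derivative_change_of_chart[OF immersed_surface_chart(1)[OF assms]
        immersed_surface_chart(1)[OF assms(1) that] assms(3) that(2)
        smooth_atlas_transition[OF at that(1) assms(2) that(2) assms(3)]
        immersed_surface_chart(2)[OF assms]]
    by auto
  then show ?thesis
    unfolding tangent_plane_def using assms(2,3) by fastforce
qed

text \<open>The description in the definition of \<^const>\<open>tangent_differential\<close> determines the value:
  two vectors that represent the same tangent vector in two charts correspond under the
  differential of the transition map, as \<open>f\<close> is an immersion, and so \<open>g\<close> sends them to the same vector.\<close>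

lemma tangent_differential_chart:
  assumes f: "immersed_surface M A f" and U: "(U, \<phi>) \<in> A" "p \<in> U"
    and g: "(g \<circ> inv_into U \<phi>) differentiable (at (\<phi> p))"
  shows "tangent_differential A f g p (frechet_derivative (f \<circ> inv_into U \<phi>) (at (\<phi> p)) v) =
    frechet_derivative (g \<circ> inv_into U \<phi>) (at (\<phi> p)) v"
proof -
  have at: "smooth_atlas M A" using f by (simp add: immersed_surface_def)
  have "frechet_derivative (g \<circ> inv_into V \<psi>) (at (\<psi> p)) v' =
      frechet_derivative (g \<circ> inv_into U \<phi>) (at (\<phi> p)) v"
    if V: "(V, \<psi>) \<in> A" "p \<in> V"
      and eq: "frechet_derivative (f \<circ> inv_into U \<phi>) (at (\<phi> p)) v =
        frechet_derivative (f \<circ> inv_into V \<psi>) (at (\<psi> p)) v'" for V \<psi> v'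
  proof -
    note change = frechet_derivative_change_of_chart[OF immersed_surface_chart(1)[OF f U]
        immersed_surface_chart(1)[OF f V] U(2) V(2) smooth_atlas_transition[OF at V(1) U(1) V(2) U(2)]]
    have "v = frechet_derivative (\<phi> \<circ> inv_into V \<psi>) (at (\<psi> p)) v'"
      using immersed_surface_chart(3)[OF f U] eq
      by (simp add: change[OF immersed_surface_chart(2)[OF f U]] inj_eq)
    then show ?thesis
      by (simp add: change[OF g])
  qed
  note unique = this
  show ?thesis
    unfolding tangent_differential_def
  proof (rule the_equality)
    fix u assume "\<exists>(V, \<psi>)\<in>A. p \<in> V \<and>
        (\<exists>v'. frechet_derivative (f \<circ> inv_into U \<phi>) (at (\<phi> p)) v =
            frechet_derivative (f \<circ> inv_into V \<psi>) (at (\<psi> p)) v' \<and>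
          u = frechet_derivative (g \<circ> inv_into V \<psi>) (at (\<psi> p)) v')"
    then show "u = frechet_derivative (g \<circ> inv_into U \<phi>) (at (\<phi> p)) v"
      using unique by blast
  qed (use U in blast)
qed

section \<open>Determinants of endomorphisms of a plane\<close>

text \<open>A frame \<open>b\<close> of a subspace as a linear isomorphism from coordinate vectors.\<close>

lemma independent_range_frame:
  fixes b :: "'n::finite \<Rightarrow> 'a::real_vector"
  assumes "inj b" "independent (range b)"
  shows "linear (\<lambda>c::real^'n. \<Sum>j\<in>UNIV. c $ j *\<^sub>R b j)"
    and "inj (\<lambda>c::real^'n. \<Sum>j\<in>UNIV. c $ j *\<^sub>R b j)"
    and "range (\<lambda>c::real^'n. \<Sum>j\<in>UNIV. c $ j *\<^sub>R b j) = span (range b)"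
proof -
  let ?B = "\<lambda>c::real^'n. \<Sum>j\<in>UNIV. c $ j *\<^sub>R b j"
  show lin: "linear ?B"
    by (rule linearI) (simp_all add: scaleR_left_distrib sum.distrib scaleR_sum_right)
  have B: "?B c = (\<Sum>v\<in>range b. c $ (inv b v) *\<^sub>R v)" for c
    using assms(1) by (simp add: sum.reindex)
  show "inj ?B"
    unfolding linear_injective_0[OF lin]
  proof (intro allI impI)
    fix c assume "?B c = 0"
    then have "c $ (inv b (b j)) = 0" for j
      using independentD[OF assms(2) _ subset_refl, of "\<lambda>v. c $ (inv b v)" "b j"] B[of c] by simp
    then show "c = 0"
      using assms(1) by (simp add: vec_eq_iff)
  qed
  show "range ?B = span (range b)"
  proof
    show "range ?B \<subseteq> span (range b)"
      by (intro image_subsetI span_sum span_scale span_base rangeI)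
    show "span (range b) \<subseteq> range ?B"
    proof
      fix w assume "w \<in> span (range b)"
      then obtain u where "w = (\<Sum>v\<in>range b. u v *\<^sub>R v)"
        by (auto simp: span_finite)
      also have "\<dots> = ?B (\<chi> j. u (b j))"
        using assms(1) by (simp add: sum.reindex)
      finally show "w \<in> range ?B" by blast
    qed
  qed
qed

text \<open>Here \<open>F\<close> stands for \<open>df\<^sub>p\<close> and \<open>E\<close> for \<open>d\<eta>\<^sub>p\<close> in a chart. If \<open>E\<close> has a kernel, then \<open>L\<close> is singular, and
  so is its matrix in every basis. Thus \<open>0\<close> is the unique value in the definition of
  \<^const>\<open>plane_det\<close>, without any comparison of the matrices in two bases. The hypothesis
  \<open>range E \<subseteq> range F\<close> ensures that there is a matrix at all.\<close>

lemma plane_det_eq_0: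
  fixes F E :: "real^2 \<Rightarrow> real^3"
  assumes F: "linear F" "inj F" and E: "linear E" "\<not> inj E" "range E \<subseteq> range F"
    and L: "\<And>v. L (F v) = E v"
  shows "plane_det (range F) L = 0"
  unfolding plane_det_def
proof (rule the_equality)
  obtain u where u: "u \<noteq> 0" "E u = 0"
    using E(1,2) by (auto simp: linear_injective_0)
  have det0: "det a = 0"
    if b: "inj b" "independent (range b)" "span (range b) = range F"
      and a: "\<And>j. L (b j) = (\<Sum>i\<in>UNIV. a $ i $ j *\<^sub>R b i)"
    for b :: "2 \<Rightarrow> real^3" and a :: "real^2^2"
  proof -
    let ?B = "\<lambda>c::real^2. \<Sum>j\<in>UNIV. c $ j *\<^sub>R b j"
    note B = independent_range_frame[OF b(1,2)]
    have "F u \<in> range ?B" using B(3) b(3) by blast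
    then obtain c where c: "F u = ?B c" by blast
    have "b j \<in> range F" for j
      unfolding b(3)[symmetric] by (intro span_base rangeI)
    then have "\<forall>j. \<exists>y. b j = F y" by blast
    then obtain x where x: "\<And>j. b j = F (x j)" by metis
    have "F u = F (\<Sum>j\<in>UNIV. c $ j *\<^sub>R x j)"
      using c by (simp add: x linear_sum[OF F(1)] linear_scale[OF F(1)])
    then have ux: "u = (\<Sum>j\<in>UNIV. c $ j *\<^sub>R x j)"
      using F(2) by (simp add: inj_eq)
    have "?B (a *v c) = (\<Sum>j\<in>UNIV. c $ j *\<^sub>R L (b j))"
      unfolding a matrix_vector_mult_def scaleR_sum_right
      by (subst sum.swap) (simp add: scaleR_sum_left mult.commute)
    also have "\<dots> = E u"
      by (simp add: ux x L linear_sum[OF E(1)] linear_scale[OF E(1)])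
    finally have "?B (a *v c) = 0" using u by simp
    then have "a *v c = 0"
      using B(1,2) linear_injective_0 by blast
    moreover have "c \<noteq> 0"
      using u(1) ux by auto
    ultimately show "det a = 0"
      by (metis invertible_det_nz invertible_def matrix_vector_mul_assoc matrix_vector_mul_lid matrix_vector_mult_0_right)
  qed
  let ?b = "\<lambda>j::2. F (axis j 1)"
  have axes: "(\<lambda>j::2. axis j (1::real)) ` UNIV = Basis"
    by (auto simp: Basis_vec_def)
  have injb: "inj ?b"
    by (rule injI) (metis F(2) axis_eq_axis injD zero_neq_one)
  have rb: "range ?b = F ` Basis"
    unfolding axes[symmetric] by auto
  have ind: "independent (range ?b)"
    unfolding rb using F by (intro linear_independent_injective_image independent_Basis)
      (auto intro: inj_on_subset)
  have sp: "span (range ?b) = range F"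
    unfolding rb by (simp add: linear_span_image[OF F(1)])
  have "\<exists>x. E (axis j 1) = F x" for j :: 2
    using E(3) by blast
  then obtain x where x: "\<And>j::2. E (axis j 1) = F (x j)" by metis
  have "L (?b j) = (\<Sum>i\<in>UNIV. (\<chi> i j. x j $ i) $ i $ j *\<^sub>R ?b i)" for j
  proof -
    have "F (x j) = F (\<Sum>i\<in>UNIV. x j $ i *\<^sub>R axis i 1)"
      using basis_expansion[of "x j"] by (simp add: scalar_mult_eq_scaleR)
    then show ?thesis
      by (simp add: L x linear_sum[OF F(1)] linear_scale[OF F(1)])
  qed
  then show "\<exists>(b :: 2 \<Rightarrow> real^3) (a :: real^2^2). inj b \<and> independent (range b) \<and>
      span (range b) = range F \<and> (\<forall>j. L (b j) = (\<Sum>i\<in>UNIV. a $ i $ j *\<^sub>R b i)) \<and> 0 = det a"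
    using injb ind sp det0[OF injb ind sp]
    by (intro exI[of _ ?b] exI[of _ "\<chi> i j. x j $ i"]) simp
  show "d = 0" if "\<exists>(b :: 2 \<Rightarrow> real^3) (a :: real^2^2). inj b \<and> independent (range b) \<and>
      span (range b) = range F \<and> (\<forall>j. L (b j) = (\<Sum>i\<in>UNIV. a $ i $ j *\<^sub>R b i)) \<and> d = det a" for d
    using that det0 by blast
qed

section \<open>The unit sphere of a norm\<close>

text \<open>The functional \<open>l\<close> below has kernel \<open>P\<close> and \<open>l (g x) = 1\<close>. By Birkhoff orthogonality the norm is at
  least \<open>1\<close> on the affine plane \<open>l = 1\<close>, so \<open>l \<le> N\<close> by homogeneity. Along \<open>g\<close>, which stays
  on the unit sphere, \<open>l\<close> is therefore maximal at \<open>x\<close>, and \<open>l\<close> annihilates the derivative of \<open>g\<close>.\<close>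

lemma birkhoff_orthogonal_tangent:
  fixes g :: "'a::real_normed_vector \<Rightarrow> real^3"
  assumes N: "is_norm N" and P: "subspace P" "dim P = 2" and v: "birkhoff_orthogonal N (g x) P"
    and X: "open X" "x \<in> X" "\<And>y. y \<in> X \<Longrightarrow> N (g y) = 1" and g: "(g has_derivative D) (at x)"
  shows "range D \<subseteq> P"
proof -
  obtain n where n: "n \<noteq> 0" "\<And>y. y \<in> span P \<Longrightarrow> orthogonal n y"
    using orthogonal_to_subspace_exists[of P] P(2) by auto
  have "P = {w. n \<bullet> w = 0}"
  proof (rule subspace_dim_equal)
    show "P \<subseteq> {w. n \<bullet> w = 0}"
      using n(2) span_base by (auto simp: orthogonal_def)
  qed (use P n(1) in \<open>auto simp: dim_hyperplane subspace_hyperplane\<close>)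
  then have nP: "w \<in> P \<longleftrightarrow> n \<bullet> w = 0" for w by auto
  have hom: "N (c *\<^sub>R w) = \<bar>c\<bar> * N w" for c w
    using N unfolding is_norm_def by blast
  have N0: "N w \<ge> 0" "N 0 = 0" for w
    using N unfolding is_norm_def by blast+
  have Ngx: "N (g x) = 1" using X by blast
  have orth: "N (g x + w) \<ge> 1" if "w \<in> P" for w
    using v that Ngx unfolding birkhoff_orthogonal_def by (metis scaleR_one)
  have "n \<bullet> g x \<noteq> 0"
    using orth[of "- g x"] N0 by (auto simp: nP)
  define l where "l w = (n \<bullet> w) / (n \<bullet> g x)" for w
  have l: "bounded_linear l"
    unfolding l_def by (intro bounded_linear_divide[THEN bounded_linear_compose] bounded_linear_inner_right)
  have le: "l w \<le> N w" for w
  proof (cases "l w = 0")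
    case False
    have "n \<bullet> (w /\<^sub>R l w - g x) = 0"
      using False \<open>n \<bullet> g x \<noteq> 0\<close> by (simp add: l_def inner_diff_right)
    then have "1 \<le> N (w /\<^sub>R l w)"
      using orth[of "w /\<^sub>R l w - g x"] by (simp add: nP)
    then have "1 \<le> N w / \<bar>l w\<bar>"
      by (simp add: hom divide_inverse mult.commute)
    then show ?thesis
      using False by (simp add: le_divide_eq split: if_splits)
  qed (use N0 in simp)
  have "(\<lambda>v. l (D v)) = (\<lambda>v. 0)"
  proof (rule differential_zero_maxmin[OF X(2,1)])
    show "((\<lambda>y. l (g y)) has_derivative (\<lambda>v. l (D v))) (at x)"
      using l g by (rule bounded_linear.has_derivative)
    have "l (g x) = 1" using \<open>n \<bullet> g x \<noteq> 0\<close> by (simp add: l_def)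
    then show "(\<forall>y\<in>X. l (g y) \<le> l (g x)) \<or> (\<forall>y\<in>X. l (g x) \<le> l (g y))"
      using le X(3) by metis
  qed
  then have "l (D v) = 0" for v by meson
  then show ?thesis
    using \<open>n \<bullet> g x \<noteq> 0\<close> by (auto simp: nP l_def)
qed

text \<open>Radial projection, in both directions; the norm is continuous because it is convex.\<close>

lemma homeomorphism_sphere_unit_sphere:
  assumes "is_norm N"
  obtains g h where "homeomorphism (sphere (0::real^3) 1) (unit_sphere N) g h"
proof
  have pos: "N x > 0" if "x \<noteq> 0" for x
    using assms that unfolding is_norm_def by (metis less_eq_real_def)
  have hom: "N (c *\<^sub>R x) = \<bar>c\<bar> * N x" and tri: "N (x + y) \<le> N x + N y" and N0: "N 0 = 0" for c x y
    using assms unfolding is_norm_def by blast+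
  have "convex_on UNIV N"
  proof (rule convex_onI)
    show "N ((1 - t) *\<^sub>R x + t *\<^sub>R y) \<le> (1 - t) * N x + t * N y" if "0 < t" "t < 1" for t x y
      using tri[of "(1 - t) *\<^sub>R x" "t *\<^sub>R y"] that by (simp add: hom)
  qed simp
  then have cont: "continuous_on T N" for T
    using convex_on_continuous[OF open_UNIV] continuous_on_subset by blast
  show "homeomorphism (sphere 0 1) (unit_sphere N) (\<lambda>x. x /\<^sub>R N x) (\<lambda>x. x /\<^sub>R norm x)"
  proof (rule homeomorphismI)
    have nz: "x \<noteq> 0" if "x \<in> sphere 0 1 \<or> x \<in> unit_sphere N" for x :: "real^3"
      using that N0 by (auto simp: unit_sphere_def)
    show "continuous_on (sphere 0 1) (\<lambda>x. x /\<^sub>R N x)"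
    proof (intro continuous_intros cont ballI)
      show "N x \<noteq> 0" if "x \<in> sphere 0 1" for x using pos[of x] nz[of x] that by auto
    qed
    show "continuous_on (unit_sphere N) (\<lambda>x. x /\<^sub>R norm x)"
      using nz by (intro continuous_intros) auto
    show "(\<lambda>x. x /\<^sub>R N x) ` sphere 0 1 \<subseteq> unit_sphere N"
    proof (rule image_subsetI)
      fix x :: "real^3" assume "x \<in> sphere 0 1"
      then have "N x > 0" using pos nz by blast
      then show "x /\<^sub>R N x \<in> unit_sphere N" by (simp add: unit_sphere_def hom)
    qed
    show "(\<lambda>x. x /\<^sub>R norm x) ` unit_sphere N \<subseteq> sphere 0 1"
      using nz by auto
    show "(x /\<^sub>R N x) /\<^sub>R norm (x /\<^sub>R N x) = x" if "x \<in> sphere 0 1" for x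
      using that pos[of x] nz[of x] by simp
    show "(y /\<^sub>R norm y) /\<^sub>R N (y /\<^sub>R norm y) = y" if "y \<in> unit_sphere N" for y
      using that nz[of y] by (simp add: hom unit_sphere_def)
  qed
qed

lemma unit_sphere_topology:
  assumes "is_norm N"
  shows "compact (unit_sphere N)" "simply_connected (unit_sphere N)"
    "locally path_connected (unit_sphere N)"
proof -
  obtain g h where gh: "homeomorphism (sphere (0::real^3) 1) (unit_sphere N) g h"
    using homeomorphism_sphere_unit_sphere[OF assms] .
  then have "sphere (0::real^3) 1 homeomorphic unit_sphere N"
    unfolding homeomorphic_def by blast
  then show "compact (unit_sphere N)" "simply_connected (unit_sphere N)"
    using homeomorphic_compactness[of "sphere (0::real^3) 1"] homeomorphic_simply_connected
      simply_connected_sphere[of "0::real^3" 1] by auto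
  have "path_connected S \<longleftrightarrow> path_connected T" if "homeomorphism S T g h" for S T
    using that homeomorphic_path_connectedness unfolding homeomorphic_def by blast
  then show "locally path_connected (unit_sphere N)"
    using homeomorphism_locally[OF gh, of path_connected path_connected]
      locally_path_connected_sphere by blast
qed

section \<open>The Birkhoff-Gauss map of a positively curved surface\<close>

text \<open>The hypotheses behind the local statements about \<open>\<eta>\<close>. Compactness and connectedness of the
  surface are global: they turn the local homeomorphism into a homeomorphism.\<close>

locale positively_curved_surface =
  fixes N :: "real^3 \<Rightarrow> real"
    and M :: "'m::{t2_space, second_countable_topology} set"
    and A :: "'m chart set"
    and f \<eta> :: "'m \<Rightarrow> real^3"
  assumes norm: "is_norm N" and emb: "embedded_surface (unit_sphere N)"
    and immersed: "immersed_surface M A f"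
    and gauss: "birkhoff_gauss_map N M A f \<eta>"
    and curv: "\<forall>p\<in>M. minkowski_gaussian_curvature A f \<eta> p > 0"
begin

abbreviation S :: "(real^3) set" where "S \<equiv> unit_sphere N"

lemma gauss_continuous: "continuous_on M \<eta>" "\<eta> ` M \<subseteq> S"
  using gauss by (simp_all add: birkhoff_gauss_map_def smooth_surface_map_def)

lemma sphere_chart_is_chart: "(V, \<psi>) \<in> embedded_charts S \<Longrightarrow> is_chart S (V, \<psi>)"
  by (simp add: embedded_charts_def)

lemma sphere_chart_exists:
  assumes "y \<in> S"
  obtains V \<psi> where "(V, \<psi>) \<in> embedded_charts S" "y \<in> V"
  using assms emb unfolding embedded_surface_def by fast

lemma surface_chart_exists:
  assumes "p \<in> M"
  obtains U \<phi> where "(U, \<phi>) \<in> A" "p \<in> U"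
  using assms immersed unfolding immersed_surface_def smooth_atlas_def by fast

lemma surface_chart_is_chart: "(U, \<phi>) \<in> A \<Longrightarrow> is_chart M (U, \<phi>)"
  using immersed smooth_atlas_chart unfolding immersed_surface_def by blast

lemma gauss_local:
  assumes U: "(U, \<phi>) \<in> A" and V: "(V, \<psi>) \<in> embedded_charts S"
  shows "open (\<phi> ` (U \<inter> \<eta> -` V))"
    and "smooth_on (\<phi> ` (U \<inter> \<eta> -` V)) (\<psi> \<circ> \<eta> \<circ> inv_into U \<phi>)"
proof -
  have "openin (top_of_set M) (M \<inter> \<eta> -` V)"
    using gauss_continuous is_chartD(1)[OF sphere_chart_is_chart[OF V]]
    by (intro continuous_openin_preimage[of _ _ S]) auto
  from open_chart_image[OF surface_chart_is_chart[OF U] this]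
  show "open (\<phi> ` (U \<inter> \<eta> -` V))"
    using openin_imp_subset[OF is_chartD(1)[OF surface_chart_is_chart[OF U]]]
    by (simp add: Int_assoc[symmetric] Int_absorb2)
  show "smooth_on (\<phi> ` (U \<inter> \<eta> -` V)) (\<psi> \<circ> \<eta> \<circ> inv_into U \<phi>)"
    using gauss U V unfolding birkhoff_gauss_map_def smooth_surface_map_def by fast
qed

text \<open>Since \<open>\<eta>\<close> takes values in the unit sphere, \<open>birkhoff_orthogonal_tangent\<close> applies to \<open>\<eta>\<close> in the
  chart \<open>\<phi>\<close>, and positive curvature rules out a kernel of \<open>d\<eta>\<close>. In the target chart \<open>\<psi>\<close> this
  carries over because \<open>\<eta>\<close> factors through its local representation.\<close>

lemma gauss_local_inj:
  assumes U: "(U, \<phi>) \<in> A" and V: "(V, \<psi>) \<in> embedded_charts S" and p: "p \<in> U" "\<eta> p \<in> V"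
  shows "inj (frechet_derivative (\<psi> \<circ> \<eta> \<circ> inv_into U \<phi>) (at (\<phi> p)))"
proof -
  let ?h = "\<psi> \<circ> \<eta> \<circ> inv_into U \<phi>" and ?E = "\<eta> \<circ> inv_into U \<phi>" and ?F = "f \<circ> inv_into U \<phi>"
  let ?Y = "\<phi> ` (U \<inter> \<eta> -` V)"
  let ?DF = "frechet_derivative ?F (at (\<phi> p))" and ?DE = "frechet_derivative ?E (at (\<phi> p))"
  have chU: "is_chart M (U, \<phi>)" and chV: "is_chart S (V, \<psi>)"
    using surface_chart_is_chart[OF U] sphere_chart_is_chart[OF V] .
  have UM: "U \<subseteq> M" using openin_imp_subset[OF is_chartD(1)[OF chU]] .
  have Y: "open ?Y" "\<phi> p \<in> ?Y" using gauss_local(1)[OF U V] p by auto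
  have hp: "?h (\<phi> p) = \<psi> (\<eta> p)" and Ep: "?E (\<phi> p) = \<eta> p"
    using chart_inv_into[OF chU p(1)] by simp_all
  have E: "(inv_into V \<psi> \<circ> ?h) y = ?E y" if "y \<in> ?Y" for y
    using that chart_inv_into[OF chU] chart_inv_into[OF chV] by auto
  have dh: "?h differentiable (at (\<phi> p))"
    using gauss_local(2)[OF U V] Y(2) by (rule smooth_on_differentiable)
  have "smooth_on (\<psi> ` V) (inv_into V \<psi>)"
    using V by (simp add: embedded_charts_def)
  then have dV: "inv_into V \<psi> differentiable (at (?h (\<phi> p)))"
    unfolding hp using p(2) by (intro smooth_on_differentiable) auto
  have dE: "?E differentiable (at (\<phi> p))"
    using differentiable_cong_open[OF Y E differentiable_chain_at[OF dh dV]] .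
  have DE: "?DE = frechet_derivative (inv_into V \<psi>) (at (?h (\<phi> p))) \<circ> frechet_derivative ?h (at (\<phi> p))"
    unfolding frechet_derivative_compose[OF dh dV, symmetric]
    using Y E by (intro frechet_derivative_cong_open[symmetric, of ?Y]) auto
  have linE: "linear ?DE" using linear_frechet_derivative[OF dE] .
  have F: "?F differentiable (at (\<phi> p))" "inj ?DF"
    using immersed_surface_chart(2,3)[OF immersed U p(1)] .
  have linF: "linear ?DF" using linear_frechet_derivative[OF F(1)] .
  have plane: "tangent_plane A f p = range ?DF"
    using tangent_plane_chart[OF immersed U p(1)] .
  have dim: "dim (range ?DF) = 2"
    using dim_image_eq[OF linF, of UNIV] F(2) by simp
  have "range ?DE \<subseteq> range ?DF"
  proof (rule birkhoff_orthogonal_tangent[OF norm _ dim])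
    show "subspace (range ?DF)" using linF by (simp add: linear_subspace_image)
    show "birkhoff_orthogonal N (?E (\<phi> p)) (range ?DF)"
      using gauss p(1) UM unfolding Ep plane[symmetric] birkhoff_gauss_map_def by blast
    show "open (\<phi> ` U)" "\<phi> p \<in> \<phi> ` U" using is_chartD(2)[OF chU] p(1) by auto
    show "N (?E y) = 1" if "y \<in> \<phi> ` U" for y
    proof -
      obtain u where u: "u \<in> U" "y = \<phi> u" using \<open>y \<in> \<phi> ` U\<close> by blast
      then have "?E y = \<eta> u" using chart_inv_into[OF chU] by simp
      then show ?thesis using gauss_continuous(2) UM u(1) unfolding unit_sphere_def by auto
    qed
    show "(?E has_derivative ?DE) (at (\<phi> p))" using dE by (simp add: frechet_derivative_works)
  qed
  moreover have "plane_det (range ?DF) (tangent_differential A f \<eta> p) > 0"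
    using curv p(1) UM unfolding minkowski_gaussian_curvature_def plane[symmetric] by blast
  ultimately have "inj ?DE"
    using plane_det_eq_0[OF linF F(2) linE _ _ tangent_differential_chart[OF immersed U p(1) dE]] by force
  then show ?thesis unfolding DE by (rule inj_on_imageI2)
qed

lemma gauss_local_homeomorphism: "local_homeomorphism M S \<eta>"
  unfolding local_homeomorphism_def
proof (intro ballI)
  fix p assume "p \<in> M"
  obtain U \<phi> where U: "(U, \<phi>) \<in> A" "p \<in> U" using surface_chart_exists[OF \<open>p \<in> M\<close>] .
  have "\<eta> p \<in> S" using gauss_continuous(2) \<open>p \<in> M\<close> by blast
  then obtain V \<psi> where V: "(V, \<psi>) \<in> embedded_charts S" "\<eta> p \<in> V" using sphere_chart_exists by blast
  note chU = is_chartD[OF surface_chart_is_chart[OF U(1)]]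
  note chV = is_chartD[OF sphere_chart_is_chart[OF V(1)]]
  let ?h = "\<psi> \<circ> \<eta> \<circ> inv_into U \<phi>"
  let ?Y = "\<phi> ` (U \<inter> \<eta> -` V)"
  have Y: "open ?Y" "\<phi> p \<in> ?Y" using gauss_local(1)[OF U(1) V(1)] U V by auto
  obtain r where r: "r > 0" "ball (\<phi> p) r \<subseteq> ?Y" "inj_on ?h (ball (\<phi> p) r)"
    using smooth_on_locally_injective[OF Y gauss_local(2)[OF U(1) V(1)]
        gauss_local_inj[OF U(1) V(1) U(2) V(2)]] .
  let ?B = "ball (\<phi> p) r"
  have "higher_differentiable_on ?Y ?h 0"
    using gauss_local(2)[OF U(1) V(1)] unfolding smooth_on_def by blast
  then have conth: "continuous_on ?B ?h"
    using r(2) continuous_on_subset by auto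
  have ohB: "open (?h ` ?B)"
    using invariance_of_domain[OF conth open_ball r(3)] .
  obtain k where k: "homeomorphism ?B (?h ` ?B) ?h k"
    using invariance_of_domain_homeomorphism[OF open_ball conth _ r(3)] by auto
  define W where "W = inv_into U \<phi> ` ?B"
  define Z where "Z = inv_into V \<psi> ` ?h ` ?B"
  have BU: "?B \<subseteq> \<phi> ` U" using r(2) by blast
  have hBV: "?h ` ?B \<subseteq> \<psi> ` V"
  proof
    fix y assume "y \<in> ?h ` ?B"
    then obtain x where "x \<in> ?Y" "y = ?h x" using r(2) by blast
    then show "y \<in> \<psi> ` V"
      using chart_inv_into[OF surface_chart_is_chart[OF U(1)]] by auto
  qed
  have B_W: "homeomorphism ?B W (inv_into U \<phi>) \<phi>"
    using homeomorphism_of_subsets[OF homeomorphism_symD[OF chU(3)] BU _ W_def[symmetric]]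
      homeomorphism_image2[OF chU(3)] BU unfolding W_def by blast
  have B_Z: "homeomorphism (?h ` ?B) Z (inv_into V \<psi>) \<psi>"
    using homeomorphism_of_subsets[OF homeomorphism_symD[OF chV(3)] hBV _ Z_def[symmetric]]
      homeomorphism_image2[OF chV(3)] hBV unfolding Z_def by blast
  have "homeomorphism W Z ((inv_into V \<psi> \<circ> ?h) \<circ> \<phi>) (inv_into U \<phi> \<circ> (k \<circ> \<psi>))"
    using homeomorphism_compose[OF homeomorphism_symD[OF B_W] homeomorphism_compose[OF k B_Z]] .
  then have hom: "homeomorphism W Z \<eta> (inv_into U \<phi> \<circ> (k \<circ> \<psi>))"
  proof (rule homeomorphism_cong[OF _ refl refl _ refl])
    fix w assume "w \<in> W"
    then obtain x where "x \<in> ?Y" "w = inv_into U \<phi> x" using r(2) unfolding W_def by blast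
    then obtain u where "u \<in> U" "\<eta> u \<in> V" "w = u"
      using chart_inv_into[OF surface_chart_is_chart[OF U(1)]] by auto
    then show "\<eta> w = ((inv_into V \<psi> \<circ> ?h) \<circ> \<phi>) w"
      using chart_inv_into[OF surface_chart_is_chart[OF U(1)]]
        chart_inv_into[OF sphere_chart_is_chart[OF V(1)]] by simp
  qed
  have "openin (top_of_set U) W"
    unfolding W_def using BU
    by (intro homeomorphism_imp_open_map[OF homeomorphism_symD[OF chU(3)]]) (simp add: openin_open_eq[OF chU(2)])
  then have oW: "openin (top_of_set M) W" using chU(1) openin_trans by blast
  have "openin (top_of_set V) Z"
    unfolding Z_def using hBV ohB
    by (intro homeomorphism_imp_open_map[OF homeomorphism_symD[OF chV(3)]]) (simp add: openin_open_eq[OF chV(2)])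
  then have oZ: "openin (top_of_set S) Z" using chV(1) openin_trans by blast
  have "p \<in> W"
    unfolding W_def using r(1) chart_inv_into[OF surface_chart_is_chart[OF U(1)] U(2)]
    by (metis centre_in_ball imageI)
  then show "\<exists>W Z q. p \<in> W \<and> openin (top_of_set M) W \<and> openin (top_of_set S) Z \<and> homeomorphism W Z \<eta> q"
    using oW oZ hom by (intro exI conjI)
qed

text \<open>In charts the inverse is a continuous right inverse of a local representation of \<open>\<eta>\<close>.\<close>

lemma gauss_inverse_smooth:
  assumes bij: "bij_betw \<eta> M S" and "compact M"
  shows "smooth_surface_map S (embedded_charts S) M A (inv_into M \<eta>)"
proof -
  let ?g = "inv_into M \<eta>"
  have gM: "?g ` S \<subseteq> M" and \<eta>g: "\<And>y. y \<in> S \<Longrightarrow> \<eta> (?g y) = y"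
    using bij by (auto simp: bij_betw_def inv_into_into f_inv_into_f)
  have "continuous_on (\<eta> ` M) ?g"
    using gauss_continuous(1) assms(2)
    by (rule continuous_on_inv) (use bij in \<open>simp add: bij_betw_def\<close>)
  then have contg: "continuous_on S ?g"
    using bij by (simp add: bij_betw_def)
  have "smooth_on (\<phi> ` (U \<inter> ?g -` V)) (\<psi> \<circ> ?g \<circ> inv_into U \<phi>)"
    if U: "(U, \<phi>) \<in> embedded_charts S" and V: "(V, \<psi>) \<in> A" for U \<phi> V \<psi>
  proof (rule smooth_on_right_inverse)
    note cU = sphere_chart_is_chart[OF U] and cV = surface_chart_is_chart[OF V]
    have US: "U \<subseteq> S" and VM: "V \<subseteq> M"
      using openin_imp_subset is_chartD(1)[OF cU] is_chartD(1)[OF cV] by blast+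
    let ?X = "\<phi> ` (U \<inter> ?g -` V)" and ?Y = "\<psi> ` (V \<inter> \<eta> -` U)"
    have "openin (top_of_set S) (S \<inter> ?g -` V)"
      using contg gM is_chartD(1)[OF cV] by (intro continuous_openin_preimage[of _ _ M]) auto
    from open_chart_image[OF cU this] show "open ?X"
      using US by (simp add: Int_assoc[symmetric] Int_absorb2)
    show "open ?Y" "smooth_on ?Y (\<phi> \<circ> \<eta> \<circ> inv_into V \<psi>)"
      using gauss_local[OF V U] .
    show "(\<psi> \<circ> ?g \<circ> inv_into U \<phi>) ` ?X \<subseteq> ?Y"
      using chart_inv_into[OF cU] \<eta>g US by (auto intro!: imageI)
    show "(\<phi> \<circ> \<eta> \<circ> inv_into V \<psi>) ((\<psi> \<circ> ?g \<circ> inv_into U \<phi>) x) = x" if "x \<in> ?X" for x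
      using that chart_inv_into[OF cU] chart_inv_into[OF cV] \<eta>g US by auto
    show "inj (frechet_derivative (\<phi> \<circ> \<eta> \<circ> inv_into V \<psi>) (at y))" if "y \<in> ?Y" for y
      using that gauss_local_inj[OF V U] by auto
    have 1: "continuous_on ?X (inv_into U \<phi>)" "inv_into U \<phi> ` ?X = U \<inter> ?g -` V"
    proof -
      show "continuous_on ?X (inv_into U \<phi>)"
        using homeomorphism_cont2[OF is_chartD(3)[OF cU]] by (rule continuous_on_subset) auto
      have "inv_into U \<phi> ` ?X = (\<lambda>u. inv_into U \<phi> (\<phi> u)) ` (U \<inter> ?g -` V)"
        by (simp add: image_image)
      also have "\<dots> = (\<lambda>u. u) ` (U \<inter> ?g -` V)"
        using chart_inv_into[OF cU] by (intro image_cong) auto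
      finally show "inv_into U \<phi> ` ?X = U \<inter> ?g -` V" by simp
    qed
    have 2: "continuous_on (U \<inter> ?g -` V) ?g"
      using contg US continuous_on_subset by blast
    have 3: "continuous_on (?g ` (U \<inter> ?g -` V)) \<psi>"
      using homeomorphism_cont1[OF is_chartD(3)[OF cV]] by (rule continuous_on_subset) auto
    show "continuous_on ?X (\<psi> \<circ> ?g \<circ> inv_into U \<phi>)"
      using 1 2 3 by (intro continuous_on_compose) (simp_all add: image_comp[symmetric])
  qed
  then show ?thesis
    unfolding smooth_surface_map_def using gM contg by blast
qed

end

theorem theorem3p2:
  fixes N :: "real^3 \<Rightarrow> real"
    and M :: "'m::{t2_space, second_countable_topology} set"
    and A :: "'m chart set"
    and f \<eta> :: "'m \<Rightarrow> real^3"
  assumes "admissible_norm N"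
    and "immersed_surface M A f"
    and "orientable_surface M A"
    and "compact M" and "connected M" and "M \<noteq> {}"
    and "birkhoff_gauss_map N M A f \<eta>"
    and "\<forall>p\<in>M. minkowski_gaussian_curvature A f \<eta> p > 0"
  shows "surface_diffeomorphism M A (unit_sphere N) (embedded_charts (unit_sphere N)) \<eta>"
proof -
  interpret positively_curved_surface N M A f \<eta>
    using assms(1,2,7,8) by unfold_locales (simp_all add: admissible_norm_def)
  have "bij_betw \<eta> M (unit_sphere N)"
    using gauss_local_homeomorphism assms(4-6) unit_sphere_topology[OF norm]
    by (intro local_homeomorphism_simply_connected_bij_betw)
  then show ?thesis
    using gauss_inverse_smooth assms(4,7)
    unfolding surface_diffeomorphism_def birkhoff_gauss_map_def by blast
qed

end
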